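(* Let $s,t\ge 1$ be coprime integers. Then $$\frac{\sum_{\lambda\in \mathcal{C}_s\cap \mathcal{C}_t} |\lambda|}{\sum_{\lambda\in \mathcal{C}_s\cap \mathcal{C}_t} 1} = \frac{1}{24}(s-1)(t-1)(s+t+1),$$ where the (finite) sums run over all partitions that are simultaneously $s$-cores and $t$-cores.
   Context: A partition is an infinite weakly decreasing sequence $\lambda=(\lambda_1,\lambda_2,\ldots)$ of nonnegative integers with finite size $|\lambda|=\lambda_1+\lambda_2+\cdots$. Its Young diagram is $[\lambda]=\{(r,c)\in\mathbb{Z}_{>0}^2 : c\le\lambda_r\}$, and its conjugate $\overline{\lambda}$ is defined by $\overline{\lambda}_r=\#\{c\in\mathbb{Z}_{>0}: r\le\lambda_c\}$. The hook length at $(r,c)\in[\lambda]$ is $1+(\lambda_r-r)+(\overline{\lambda}_c-c)$ (with the roles of row index $r$ and column index $c$ as in the usual hook length: $1+(\lambda_r-c)+(\overline{\lambda}_c-r)$, which is the same number). For $s\ge1$, a partition is an $s$-core if it has no hook of length $s$; $\mathcal{C}_s$ denotes the set of $s$-cores. For coprime $s,t\ge 1$ the set $\mathcal{C}_s\cap\mathcal{C}_t$ is finite. *)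

theory Defs
  imports "HOL-Analysis.Infinite_Sum"
begin

text \<open>
  A partition is a function on the positive integers. The argument 0 carries no information;
  it is normalised to 0, so that distinct functions are distinct partitions.
\<close>

definition partitions :: "(nat \<Rightarrow> nat) set" where
  "partitions = {\<mu>. \<mu> 0 = 0 \<and> antimono_on {1..} \<mu> \<and> \<mu> summable_on {1..}}"

definition psize :: "(nat \<Rightarrow> nat) \<Rightarrow> nat" where
  "psize \<mu> = (\<Sum>\<^sub>\<infinity>r\<in>{1..}. \<mu> r)"

definition young_diagram :: "(nat \<Rightarrow> nat) \<Rightarrow> (nat \<times> nat) set" where
  "young_diagram \<mu> = {(r, c). 1 \<le> r \<and> 1 \<le> c \<and> c \<le> \<mu> r}"

text \<open>
  For a partition \<open>\<mu>\<close> and \<open>r \<ge> 1\<close> the set counted here is finite; for \<open>r = 0\<close> it is infinite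
  and \<^const>\<open>card\<close> gives 0, in accordance with the normalisation above.
\<close>

definition conjugate :: "(nat \<Rightarrow> nat) \<Rightarrow> nat \<Rightarrow> nat" where
  "conjugate \<mu> r = card {c. 1 \<le> c \<and> r \<le> \<mu> c}"

text \<open>Integer-valued, since \<open>\<mu> r - r\<close> and \<open>conjugate \<mu> c - c\<close> can be negative inside the diagram.\<close>

definition hook_length :: "(nat \<Rightarrow> nat) \<Rightarrow> nat \<Rightarrow> nat \<Rightarrow> int" where
  "hook_length \<mu> r c = 1 + (int (\<mu> r) - int r) + (int (conjugate \<mu> c) - int c)"

definition cores :: "nat \<Rightarrow> (nat \<Rightarrow> nat) set" where
  "cores s = {\<mu> \<in> partitions. \<forall>(r, c) \<in> young_diagram \<mu>. hook_length \<mu> r c \<noteq> int s}"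

end

theory Submission
  imports Defs "HOL-Combinatorics.Transposition"
begin

text \<open>
  The set \<open>B = {\<mu>\<^sub>r - r | r \<ge> 1}\<close> determines \<open>\<mu>\<close>, and \<open>\<mu>\<close> is an \<open>s\<close>-core iff \<open>B - s \<subseteq> B\<close>. An \<open>s\<close>-stable
  \<open>B\<close> is determined by the set \<open>T\<close> of the least non-elements of \<open>B\<close> in the residue classes modulo
  \<open>s\<close>; the sum of \<open>T\<close> is \<open>0 + 1 + \<dots> + (s - 1)\<close>, and \<open>2 s \<bar>\<mu>\<bar>\<close> is the sum of the squares of \<open>T\<close>
  minus that of \<open>{0..<s}\<close>. If \<open>B\<close> is also \<open>t\<close>-stable, walk through \<open>T\<close> by the residues \<open>b, b + t, b + 2 t, \<dots>\<close>
  from some \<open>b \<in> T\<close>: each step changes the value by \<open>t - s z\<^sub>k\<close> with \<open>z\<^sub>k \<ge> 0\<close>, and the \<open>z\<^sub>k\<close> sum to \<open>t\<close>.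
  Thus pairs \<open>(\<mu>, b)\<close> correspond to the weak compositions of \<open>t\<close> into \<open>s\<close> parts, so every core is
  counted \<open>s\<close> times and averaging over cores becomes averaging over all compositions. There the
  sum of squares of \<open>T\<close> depends only on the pairwise differences in the walk, whose second moments
  follow from the exchangeability of the parts.
\<close>

subsection \<open>Beta sets of partitions\<close>

text \<open>Convergence in the discrete topology of the naturals means that the finite partial sums
  are eventually constant, so no element outside some finite \<open>X\<close> can
  contribute.\<close>

lemma summable_on_nat_finite_support:
  fixes f :: "'a \<Rightarrow> nat"
  assumes "f summable_on A"
  shows "finite {x \<in> A. f x \<noteq> 0}"
proof -
  obtain l where "(f has_sum l) A" using assms by (auto simp: summable_on_def)
  then have "eventually (\<lambda>F. sum f F = l) (finite_subsets_at_top A)"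
    by (simp add: has_sum_def tendsto_discrete)
  then obtain X where X: "finite X" "X \<subseteq> A"
    and sum_eq: "\<forall>Y. finite Y \<and> X \<subseteq> Y \<and> Y \<subseteq> A \<longrightarrow> sum f Y = l"
    unfolding eventually_finite_subsets_at_top by metis
  have "x \<in> X" if "x \<in> A" "f x \<noteq> 0" for x
  proof (rule ccontr)
    assume "x \<notin> X"
    then have "sum f (insert x X) = f x + sum f X" using X by simp
    moreover have "sum f (insert x X) = l" "sum f X = l"
      using sum_eq X that by (metis finite_insert insert_subset subset_insertI, metis order_refl)
    ultimately show False using that by simp
  qed
  then show ?thesis by (intro finite_subset[OF _ X(1)]) auto
qed

lemma partition_antimono:
  assumes "\<mu> \<in> partitions" "1 \<le> r" "r \<le> r'"
  shows "\<mu> r' \<le> \<mu> r"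
  using assms monotone_onD[of "{1..}" "(\<le>)" "(\<ge>)" \<mu> r r'] by (auto simp: partitions_def)

lemma partition_finite_length:
  assumes "\<mu> \<in> partitions"
  obtains R where "\<And>r. r > R \<Longrightarrow> \<mu> r = 0"
proof -
  have "finite {r \<in> {1..}. \<mu> r \<noteq> 0}"
    using assms by (intro summable_on_nat_finite_support) (simp add: partitions_def)
  then obtain R where "\<forall>r \<in> {r \<in> {1..}. \<mu> r \<noteq> 0}. r \<le> R"
    using finite_nat_set_iff_bounded_le by auto
  then have "\<mu> r = 0" if "r > R" for r
    using that by (metis (mono_tags, lifting) CollectI atLeast_iff less_one not_le order.strict_trans2 zero_le less_imp_le_nat)
  then show thesis using that by blast
qed

lemma psize_eq_sum:
  assumes "\<And>r. r > R \<Longrightarrow> \<mu> r = 0"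
  shows "psize \<mu> = (\<Sum>r\<in>{1..R}. \<mu> r)"
proof -
  have "psize \<mu> = infsum \<mu> {1..R}"
    unfolding psize_def using assms by (intro infsum_cong_neutral) auto
  then show ?thesis by simp
qed

lemma partitionsI:
  assumes "\<mu> 0 = 0" "\<And>r r'. 1 \<le> r \<Longrightarrow> r \<le> r' \<Longrightarrow> \<mu> r' \<le> \<mu> r" "\<And>r. r > R \<Longrightarrow> \<mu> r = 0"
  shows "\<mu> \<in> partitions"
proof -
  have "\<mu> summable_on {1..} \<longleftrightarrow> \<mu> summable_on {1..R}"
    using assms(3) by (intro summable_on_cong_neutral) auto
  then have "\<mu> summable_on {1..}" by simp
  then show ?thesis using assms(1,2) by (auto simp: partitions_def intro!: monotone_onI)
qed

lemma down_closed_eq_atLeastAtMost: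
  fixes S :: "nat set"
  assumes "finite S" "\<And>r r'. 1 \<le> r \<Longrightarrow> r \<le> r' \<Longrightarrow> r' \<in> S \<Longrightarrow> r \<in> S" "0 \<notin> S"
  shows "S = {1..card S}"
proof (cases "S = {}")
  case False
  have "S = {1..Max S}"
  proof (intro equalityI subsetI)
    fix r assume "r \<in> S"
    moreover have "r \<noteq> 0" using \<open>r \<in> S\<close> assms(3) by metis
    ultimately show "r \<in> {1..Max S}" using assms(1) by simp
  next
    fix r assume "r \<in> {1..Max S}"
    then show "r \<in> S" using assms(2)[of r "Max S"] Max_in[OF assms(1) False] by simp
  qed
  moreover from this have "card S = Max S" by (metis card_atLeastAtMost diff_Suc_1)
  ultimately show ?thesis by simp
qed simp

text \<open>The rows meeting column \<open>c\<close> form an initial segment because the rows weakly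
  decrease, and its length is \<open>conjugate \<mu> c\<close>.\<close>

lemma le_conjugate_iff:
  assumes "\<mu> \<in> partitions" "1 \<le> r" "1 \<le> c"
  shows "r \<le> conjugate \<mu> c \<longleftrightarrow> c \<le> \<mu> r"
proof -
  let ?S = "{r. 1 \<le> r \<and> c \<le> \<mu> r}"
  obtain R where R: "\<And>r. r > R \<Longrightarrow> \<mu> r = 0" using partition_finite_length[OF assms(1)] by metis
  have "r \<le> R" if "r \<in> ?S" for r
    using that R[of r] assms(3) by (cases "r \<le> R") auto
  then have "?S \<subseteq> {..R}" by blast
  then have "finite ?S" using finite_subset by blast
  then have "?S = {1..card ?S}"
    by (rule down_closed_eq_atLeastAtMost)
       (use partition_antimono[OF assms(1)] in \<open>force intro: order_trans\<close>)+
  then have "r \<in> ?S \<longleftrightarrow> r \<in> {1..conjugate \<mu> c}" unfolding conjugate_def by metis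
  then show ?thesis using assms(2) by simp
qed

text \<open>The beta set (Maya diagram) in charge-zero form. Empty rows are included, so for a
  partition all sufficiently negative integers are members and no number of parts has to be
  chosen.\<close>

definition beta :: "(nat \<Rightarrow> nat) \<Rightarrow> int set" where
  "beta \<mu> = (\<lambda>r. int (\<mu> r) - int r) ` {1..}"

lemma beta_strict_antimono:
  assumes "\<mu> \<in> partitions" "1 \<le> r" "r < r'"
  shows "int (\<mu> r') - int r' < int (\<mu> r) - int r"
  using partition_antimono[OF assms(1,2), of r'] assms(3) by simp

text \<open>Along the boundary path of the diagram the row steps give the beta numbers and the
  column steps give the gaps; together they exhaust the integers without overlap.\<close>

lemma notin_beta_iff:
  assumes "\<mu> \<in> partitions"
  shows "y \<notin> beta \<mu> \<longleftrightarrow> (\<exists>c\<ge>1. y = int c - 1 - int (conjugate \<mu> c))"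
proof
  assume y: "y \<notin> beta \<mu>"
  let ?S = "{r. 1 \<le> r \<and> y < int (\<mu> r) - int r}"
  obtain R where R: "\<And>r. r > R \<Longrightarrow> \<mu> r = 0" using partition_finite_length[OF assms] by metis
  have "r \<le> max R (nat (- y))" if "r \<in> ?S" for r
    using that R[of r] by (cases "r \<le> R") auto
  then have "?S \<subseteq> {..max R (nat (- y))}" by blast
  then have "finite ?S" using finite_subset by blast
  then have S: "?S = {1..card ?S}"
  proof (rule down_closed_eq_atLeastAtMost)
    fix r r' :: nat assume "1 \<le> r" "r \<le> r'" "r' \<in> ?S"
    then show "r \<in> ?S" using beta_strict_antimono[OF assms, of r r'] by (cases "r = r'") auto
  qed simp
  \<comment> \<open>The rows with beta number above \<open>y\<close> are exactly the first
    \<open>n\<close>. The column sought must therefore have length \<open>n\<close>, which forces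
    \<open>c = y + 1 + n\<close>.\<close>
  define n where "n = card ?S"
  have iff: "y < int (\<mu> r) - int r \<longleftrightarrow> r \<le> n" if "1 \<le> r" for r
  proof -
    have "r \<in> ?S \<longleftrightarrow> r \<in> {1..n}" using S unfolding n_def by metis
    then show ?thesis using that by simp
  qed
  have "int (\<mu> (Suc n)) - int (Suc n) \<noteq> y" using y unfolding beta_def by force
  then have Suc_n: "int (\<mu> (Suc n)) < y + 1 + int n" using iff[of "Suc n"] by simp
  define c where "c = nat (y + 1 + int n)"
  have c: "int c = y + 1 + int n" "1 \<le> c" using Suc_n by (auto simp: c_def)
  have "\<not> Suc n \<le> conjugate \<mu> c"
    using le_conjugate_iff[OF assms _ c(2), of "Suc n"] Suc_n c(1) by simp
  moreover have "n \<le> conjugate \<mu> c"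
  proof (cases "n = 0")
    case False
    then have "y < int (\<mu> n) - int n" using iff[of n] by simp
    then show ?thesis using le_conjugate_iff[OF assms _ c(2), of n] c(1) False by simp
  qed simp
  ultimately have "conjugate \<mu> c = n" by simp
  then show "\<exists>c\<ge>1. y = int c - 1 - int (conjugate \<mu> c)" using c by auto
next
  assume "\<exists>c\<ge>1. y = int c - 1 - int (conjugate \<mu> c)"
  then obtain c where c: "1 \<le> c" "y = int c - 1 - int (conjugate \<mu> c)" by blast
  show "y \<notin> beta \<mu>"
  proof
    assume "y \<in> beta \<mu>"
    then obtain r where r: "1 \<le> r" "y = int (\<mu> r) - int r" by (auto simp: beta_def)
    \<comment> \<open>If the cell \<open>(r, c)\<close> lies in the diagram, the beta number of row
      \<open>r\<close> exceeds the gap of column \<open>c\<close>; otherwise it is smaller.\<close>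
    show False
      using le_conjugate_iff[OF assms r(1) c(1)] r c by (cases "c \<le> \<mu> r") auto
  qed
qed

text \<open>The hook length at \<open>(r, c)\<close> is the beta number of row \<open>r\<close>
  minus the gap belonging to column \<open>c\<close>. A hook of length \<open>s\<close> is thus an
  \<open>x\<close> in the beta set with \<open>x - s\<close> outside it.\<close>

lemma cores_iff_beta:
  assumes "1 \<le> s"
  shows "\<mu> \<in> cores s \<longleftrightarrow> \<mu> \<in> partitions \<and> (\<forall>x\<in>beta \<mu>. x - int s \<in> beta \<mu>)"
proof (cases "\<mu> \<in> partitions")
  case True
  have "(\<exists>(r, c) \<in> young_diagram \<mu>. hook_length \<mu> r c = int s) \<longleftrightarrow>
        (\<exists>x\<in>beta \<mu>. x - int s \<notin> beta \<mu>)"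
  proof
    assume "\<exists>(r, c) \<in> young_diagram \<mu>. hook_length \<mu> r c = int s"
    then obtain r c where rc: "1 \<le> r" "1 \<le> c" "c \<le> \<mu> r" "hook_length \<mu> r c = int s"
      by (auto simp: young_diagram_def)
    have "int (\<mu> r) - int r - int s = int c - 1 - int (conjugate \<mu> c)"
      using rc(4) by (simp add: hook_length_def)
    then have "int (\<mu> r) - int r - int s \<notin> beta \<mu>"
      using notin_beta_iff[OF True] rc(2) by blast
    then show "\<exists>x\<in>beta \<mu>. x - int s \<notin> beta \<mu>" using rc(1) by (auto simp: beta_def)
  next
    assume "\<exists>x\<in>beta \<mu>. x - int s \<notin> beta \<mu>"
    then obtain r where r: "1 \<le> r" "int (\<mu> r) - int r - int s \<notin> beta \<mu>"
      by (auto simp: beta_def)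
    then obtain c where c: "1 \<le> c" "int (\<mu> r) - int r - int s = int c - 1 - int (conjugate \<mu> c)"
      using notin_beta_iff[OF True] by blast
    \<comment> \<open>A cell outside the diagram would make the beta number smaller than the gap,
      but their difference is \<open>s \<ge> 1\<close>.\<close>
    have "c \<le> \<mu> r"
      using le_conjugate_iff[OF True r(1) c(1)] c(2) assms by (cases "c \<le> \<mu> r") auto
    moreover have "hook_length \<mu> r c = int s" using c(2) by (simp add: hook_length_def)
    ultimately show "\<exists>(r, c) \<in> young_diagram \<mu>. hook_length \<mu> r c = int s"
      using r(1) c(1) by (auto simp: young_diagram_def)
  qed
  then show ?thesis using True unfolding cores_def by blast
qed (simp add: cores_def)

text \<open>Beta numbers strictly decrease with the row, so row \<open>r\<close> is recovered from
  the \<open>r\<close>-th largest element, by strong induction on \<open>r\<close>.\<close>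

lemma inj_on_beta: "inj_on beta partitions"
proof (rule inj_onI)
  fix \<mu> \<nu> assume \<mu>: "\<mu> \<in> partitions" and \<nu>: "\<nu> \<in> partitions" and eq: "beta \<mu> = beta \<nu>"
  have le: "\<alpha> r \<ge> \<beta> r" if \<alpha>: "\<alpha> \<in> partitions" and \<beta>: "\<beta> \<in> partitions"
    and sub: "beta \<beta> \<subseteq> beta \<alpha>" and r: "1 \<le> r" and IH: "\<And>r'. 1 \<le> r' \<Longrightarrow> r' < r \<Longrightarrow> \<alpha> r' = \<beta> r'" for \<alpha> \<beta> :: "nat \<Rightarrow> nat" and r
  proof -
    obtain r' where r': "1 \<le> r'" "int (\<beta> r) - int r = int (\<alpha> r') - int r'"
      using sub r by (auto simp: beta_def)
    have "\<not> r' < r"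
      using beta_strict_antimono[OF \<beta> r'(1), of r] IH[OF r'(1)] r'(2) by fastforce
    then show ?thesis
      using beta_strict_antimono[OF \<alpha> r, of r'] r'(2) by (cases "r = r'") auto
  qed
  have "1 \<le> r \<longrightarrow> \<mu> r = \<nu> r" for r
  proof (induction r rule: less_induct)
    case (less r)
    then show ?case using le[OF \<mu> \<nu>, of r] le[OF \<nu> \<mu>, of r] eq by (metis order_antisym order_refl)
  qed
  moreover have "\<mu> 0 = \<nu> 0" using \<mu> \<nu> by (simp add: partitions_def)
  ultimately show "\<mu> = \<nu>" by (metis ext less_one not_le)
qed

text \<open>The empty rows beyond \<open>R\<close> supply precisely the integers below
  \<open>-R\<close>, and the first \<open>R\<close> rows supply the rest.\<close>

lemma beta_truncate:
  assumes "\<And>r. r > R \<Longrightarrow> \<mu> r = 0"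
  shows "beta \<mu> \<inter> {- int R..} = (\<lambda>r. int (\<mu> r) - int r) ` {1..R}"
    and "x < - int R \<Longrightarrow> x \<in> beta \<mu>"
proof -
  have "r \<le> R" if "- int R \<le> int (\<mu> r) - int r" for r
    using assms[of r] that by (cases "r \<le> R") auto
  then show "beta \<mu> \<inter> {- int R..} = (\<lambda>r. int (\<mu> r) - int r) ` {1..R}"
    by (auto simp: beta_def)
next
  assume "x < - int R"
  then have "x = int (\<mu> (nat (- x))) - int (nat (- x))" "1 \<le> nat (- x)"
    using assms[of "nat (- x)"] by auto
  then show "x \<in> beta \<mu>" unfolding beta_def by blast
qed

lemma sum_beta_truncate:
  assumes "\<mu> \<in> partitions" "\<And>r. r > R \<Longrightarrow> \<mu> r = 0"
  shows "(\<Sum>x\<in>beta \<mu> \<inter> {- int R..}. h x) = (\<Sum>r\<in>{1..R}. h (int (\<mu> r) - int r))"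
proof -
  have "inj_on (\<lambda>r. int (\<mu> r) - int r) {1..R}"
  proof (rule linorder_inj_onI)
    fix r r' assume "r < r'" "r \<in> {1..R}"
    then show "int (\<mu> r) - int r \<noteq> int (\<mu> r') - int r'"
      using beta_strict_antimono[OF assms(1), of r r'] by simp
  qed auto
  then show ?thesis using assms(2) by (simp add: beta_truncate(1) sum.reindex)
qed

text \<open>The cardinality condition says that the charge is zero: as many elements at or above
  \<open>-R\<close> as there are integers from \<open>-R\<close> to \<open>-1\<close>. Row
  \<open>r\<close> is built from the \<open>r\<close>-th largest element, which is entry
  \<open>R - r\<close> of the increasing list.\<close>

lemma beta_surj:
  assumes low: "\<And>x. x < - int R \<Longrightarrow> x \<in> B"
    and fin: "finite (B \<inter> {- int R..})" and card: "card (B \<inter> {- int R..}) = R"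
  obtains \<mu> where "\<mu> \<in> partitions" "beta \<mu> = B"
proof -
  define xs where "xs = sorted_list_of_set (B \<inter> {- int R..})"
  have len: "length xs = R" and set: "set xs = B \<inter> {- int R..}"
    using fin card by (simp_all add: xs_def)
  have strict: "xs ! i < xs ! j" if "i < j" "j < R" for i j
    using that len strict_sorted_list_of_set[of "B \<inter> {- int R..}"]
    by (metis sorted_wrt_nth_less xs_def)
  have gap: "xs ! i + int k \<le> xs ! (i + k)" if "i + k < R" for i k
    using that
  proof (induction k)
    case (Suc k)
    then show ?case using strict[of "i + k" "i + Suc k"] by simp
  qed simp
  \<comment> \<open>This bound makes the rows nonnegative, so that \<open>nat\<close> in the
    definition of \<open>\<mu>\<close> loses nothing.\<close>
  have lower: "- int R + int i \<le> xs ! i" if "i < R" for i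
  proof -
    have "xs ! 0 \<in> B \<inter> {- int R..}" using set len that by (metis nth_mem not_less_zero gr_zeroI)
    then show ?thesis using gap[of 0 i] that by simp
  qed
  define \<mu> where "\<mu> r = (if 1 \<le> r \<and> r \<le> R then nat (xs ! (R - r) + int r) else 0)" for r
  have \<mu>: "int (\<mu> r) = xs ! (R - r) + int r" if "1 \<le> r" "r \<le> R" for r
    using lower[of "R - r"] that by (simp add: \<mu>_def)
  have \<mu>0: "\<mu> r = 0" if "r > R" for r using that by (simp add: \<mu>_def)
  have "\<mu> \<in> partitions"
  proof (rule partitionsI)
    show "\<mu> 0 = 0" by (simp add: \<mu>_def)
    fix r r' :: nat assume r: "1 \<le> r" "r \<le> r'"
    show "\<mu> r' \<le> \<mu> r"
    proof (cases "r' \<le> R")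
      case True
      then have "R - r' + (r' - r) = R - r" using r by simp
      then have "xs ! (R - r') + int (r' - r) \<le> xs ! (R - r)"
        using gap[of "R - r'" "r' - r"] r True by simp
      then have "int (\<mu> r') \<le> int (\<mu> r)" using \<mu>[of r] \<mu>[of r'] r True by (simp add: of_nat_diff)
      then show ?thesis by simp
    qed (simp add: \<mu>_def)
  qed (rule \<mu>0)
  moreover have "beta \<mu> = B"
  proof -
    have "(\<lambda>r. int (\<mu> r) - int r) ` {1..R} = (\<lambda>r. xs ! (R - r)) ` {1..R}"
      using \<mu> by (intro image_cong) auto
    also have "\<dots> = (!) xs ` ((\<lambda>r. R - r) ` {1..R})" by (simp add: image_image)
    also have "(\<lambda>r. R - r) ` {1..R} = {0..<R}"
    proof (intro equalityI subsetI)
      fix i assume "i \<in> {0..<R}"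
      then have "i = R - (R - i)" "R - i \<in> {1..R}" by auto
      then show "i \<in> (\<lambda>r. R - r) ` {1..R}" by blast
    qed auto
    also have "(!) xs ` {0..<R} = set xs" using len by (metis list.set_map map_nth set_upt)
    finally have "beta \<mu> \<inter> {- int R..} = B \<inter> {- int R..}"
      using beta_truncate(1)[of R \<mu>] \<mu>0 set by simp
    moreover have "x \<in> beta \<mu> \<longleftrightarrow> x \<in> B" if "x < - int R" for x
      using beta_truncate(2)[of R \<mu> x] \<mu>0 low that by blast
    ultimately show ?thesis by (auto simp: set_eq_iff) (metis not_le)+
  qed
  ultimately show thesis using that by blast
qed

subsection \<open>The first gaps in the residue classes\<close>

text \<open>For an \<open>s\<close>-stable set a nonmember preceded by a member in its residue class
  is the least nonmember of that class.\<close>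

definition first_gaps :: "nat \<Rightarrow> int set \<Rightarrow> int set" where
  "first_gaps s B = {x. x \<notin> B \<and> x - int s \<in> B}"

text \<open>Meant as the inverse of \<open>first_gaps s\<close>. The factor \<open>k + 1\<close>
  makes the descent strict, so that the elements of \<open>T\<close> themselves become gaps.\<close>

definition below :: "nat \<Rightarrow> int set \<Rightarrow> int set" where
  "below s T = {x. \<exists>k::nat. x + (int k + 1) * int s \<in> T}"

text \<open>The image of the simultaneous cores under \<open>first_gaps s\<close>. The first
  conditions describe a complete residue system; the sum, doubled to avoid a division, encodes
  charge zero; the last condition, that the gap congruent to \<open>b + t\<close> is at most
  \<open>b + t\<close>, encodes \<open>t\<close>-stability.\<close>

definition first_gap_sets :: "nat \<Rightarrow> nat \<Rightarrow> int set set" where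
  "first_gap_sets s t = {T. finite T \<and> card T = s \<and> (\<forall>b\<in>T. \<forall>b'\<in>T. int s dvd b - b' \<longrightarrow> b = b')
    \<and> 2 * \<Sum>T = int s * (int s - 1) \<and> (\<forall>b\<in>T. \<exists>k::nat. b + int t - int k * int s \<in> T)}"

lemma sum_int_interval:
  "(\<Sum>x\<in>{L..<L + int s}. h x) = (\<Sum>i<s. h (L + int i))"
proof (rule sum.reindex_bij_witness[where i = "\<lambda>i. L + int i" and j = "\<lambda>x. nat (x - L)"])
qed auto

lemma two_sum_lessThan: "2 * (\<Sum>i<s. int i) = int s * (int s - 1)"
  by (induction s) (auto simp: algebra_simps)

lemma iterate_shift:
  assumes "\<And>x. x \<in> B \<Longrightarrow> x - int s \<in> B" "x \<in> B"
  shows "x - int k * int s \<in> B"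
proof (induction k)
  case (Suc k)
  then show ?case using assms(1)[of "x - int k * int s"] by (simp add: algebra_simps)
qed (use assms(2) in simp)

text \<open>Both sides decompose the part of \<open>B + s\<close> above \<open>L\<close>, completed by an interval of length \<open>s\<close>.\<close>

lemma first_gaps_telescope:
  fixes h :: "int \<Rightarrow> 'a::comm_monoid_add"
  assumes "\<And>x. x \<in> B \<Longrightarrow> x - int s \<in> B" "\<And>x. x < L \<Longrightarrow> x \<in> B" "finite (B \<inter> {L..})"
  shows "finite (first_gaps s B)"
    and "(\<Sum>x\<in>B \<inter> {L..}. h (x + int s)) + (\<Sum>x\<in>{L..<L + int s}. h x)
      = (\<Sum>x\<in>B \<inter> {L..}. h x) + (\<Sum>x\<in>first_gaps s B. h x)"
proof -
  let ?B = "B \<inter> {L..}" and ?T = "first_gaps s B"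
  have T_ge: "L \<le> x" if "x \<in> ?T" for x
    using assms(2)[of x] that by (force simp: first_gaps_def)
  have split: "(\<lambda>x. x + int s) ` ?B \<union> {L..<L + int s} = ?B \<union> ?T"
  proof (intro equalityI subsetI)
    fix x assume "x \<in> (\<lambda>x. x + int s) ` ?B \<union> {L..<L + int s}"
    moreover have "x - int s \<in> B" if "x < L + int s" using assms(2) that by simp
    ultimately show "x \<in> ?B \<union> ?T" by (auto simp: first_gaps_def)
  next
    fix x assume x: "x \<in> ?B \<union> ?T"
    then have ge: "L \<le> x" using T_ge by auto
    show "x \<in> (\<lambda>x. x + int s) ` ?B \<union> {L..<L + int s}"
    proof (cases "x < L + int s")
      case False
      have "x - int s \<in> B" using x assms(1) by (auto simp: first_gaps_def)
      then have "x - int s \<in> ?B" using False by simp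
      then have "x \<in> (\<lambda>x. x + int s) ` ?B" by (intro image_eqI[of _ _ "x - int s"]) auto
      then show ?thesis by simp
    qed (use ge in simp)
  qed
  have "finite (?B \<union> ?T)" unfolding split[symmetric] using assms(3) by simp
  then show finT: "finite ?T" by simp
  have "(\<Sum>x\<in>?B. h (x + int s)) + (\<Sum>x\<in>{L..<L + int s}. h x)
    = (\<Sum>x\<in>(\<lambda>x. x + int s) ` ?B. h x) + (\<Sum>x\<in>{L..<L + int s}. h x)"
    by (simp add: sum.reindex)
  also have "\<dots> = (\<Sum>x\<in>(\<lambda>x. x + int s) ` ?B \<union> {L..<L + int s}. h x)"
    using assms(3) by (subst sum.union_disjoint) auto
  also have "\<dots> = (\<Sum>x\<in>?B. h x) + (\<Sum>x\<in>?T. h x)"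
    unfolding split using assms(3) finT by (subst sum.union_disjoint) (auto simp: first_gaps_def)
  finally show "(\<Sum>x\<in>?B. h (x + int s)) + (\<Sum>x\<in>{L..<L + int s}. h x)
      = (\<Sum>x\<in>?B. h x) + (\<Sum>x\<in>?T. h x)" .
qed

text \<open>The telescoping identity for \<open>h = 1\<close>, \<open>x\<close> and
  \<open>x\<^sup>2\<close>. The leading power sum of \<open>B\<close> cancels each time, so the
  squares of the gaps see only the sum and the number of the truncated elements.\<close>

lemma sum_first_gaps:
  assumes "\<And>x. x \<in> B \<Longrightarrow> x - int s \<in> B" "\<And>x. x < L \<Longrightarrow> x \<in> B" "finite (B \<inter> {L..})"
  shows "card (first_gaps s B) = s"
    and "2 * \<Sum>(first_gaps s B) = int s * (int s - 1) + 2 * int s * (int (card (B \<inter> {L..})) + L)"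
    and "(\<Sum>b\<in>first_gaps s B. b\<^sup>2) = 2 * int s * \<Sum>(B \<inter> {L..}) + (int s)\<^sup>2 * int (card (B \<inter> {L..}))
      + (\<Sum>i<s. (int i)\<^sup>2) + L * int s * (int s - 1) + int s * L\<^sup>2"
proof -
  let ?B = "B \<inter> {L..}"
  show "card (first_gaps s B) = s"
    using first_gaps_telescope(2)[OF assms, where h = "\<lambda>_. 1 :: nat"] by simp
  have "(\<Sum>x\<in>?B. x + int s) + (\<Sum>i<s. L + int i) = \<Sum>?B + \<Sum>(first_gaps s B)"
    using first_gaps_telescope(2)[OF assms, where h = "\<lambda>x. x"] by (simp add: sum_int_interval)
  then show "2 * \<Sum>(first_gaps s B) = int s * (int s - 1) + 2 * int s * (int (card ?B) + L)"
    using two_sum_lessThan[of s] by (simp add: sum.distrib algebra_simps)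
  have "(\<Sum>x\<in>?B. (x + int s)\<^sup>2) + (\<Sum>i<s. (L + int i)\<^sup>2) = (\<Sum>x\<in>?B. x\<^sup>2) + (\<Sum>b\<in>first_gaps s B. b\<^sup>2)"
    using first_gaps_telescope(2)[OF assms, where h = "\<lambda>x. x\<^sup>2"] by (simp add: sum_int_interval)
  moreover have "(\<Sum>x\<in>?B. (x + int s)\<^sup>2) = (\<Sum>x\<in>?B. x\<^sup>2) + 2 * int s * \<Sum>?B + (int s)\<^sup>2 * int (card ?B)"
    by (simp add: power2_sum sum.distrib sum_distrib_left mult_ac)
  moreover have "(\<Sum>i<s. (L + int i)\<^sup>2) = int s * L\<^sup>2 + L * (2 * (\<Sum>i<s. int i)) + (\<Sum>i<s. (int i)\<^sup>2)"
    by (simp add: power2_sum sum.distrib sum_distrib_left mult_ac)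
  ultimately show "(\<Sum>b\<in>first_gaps s B. b\<^sup>2) = 2 * int s * \<Sum>?B + (int s)\<^sup>2 * int (card ?B)
      + (\<Sum>i<s. (int i)\<^sup>2) + L * int s * (int s - 1) + int s * L\<^sup>2"
    unfolding two_sum_lessThan by (simp add: mult_ac)
qed

text \<open>Climbing from a member in steps of \<open>s\<close> must leave the bounded set
  \<open>B\<close>, and the first exit is a first gap.\<close>

lemma below_first_gaps:
  assumes "1 \<le> s" "\<And>x. x \<in> B \<Longrightarrow> x - int s \<in> B" "\<And>x. x \<in> B \<Longrightarrow> x \<le> M"
  shows "below s (first_gaps s B) = B"
proof (intro equalityI subsetI)
  fix x assume "x \<in> below s (first_gaps s B)"
  then obtain k :: nat where "x + (int k + 1) * int s - int s \<in> B"
    by (auto simp: below_def first_gaps_def)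
  then show "x \<in> B"
    using iterate_shift[where B = B and s = s and k = k, OF assms(2)] by (force simp: algebra_simps)
next
  fix x assume x: "x \<in> B"
  define P where "P k \<longleftrightarrow> x + int k * int s \<notin> B" for k
  have "x + int (nat (M - x + 1)) * int s > M"
  proof -
    have "int (nat (M - x + 1)) * 1 \<le> int (nat (M - x + 1)) * int s"
      using assms(1) by (intro mult_left_mono) auto
    then show ?thesis using assms(3)[OF x] by linarith
  qed
  then have "P (nat (M - x + 1))" unfolding P_def using assms(3) by (meson not_le)
  then have least: "P (LEAST k. P k)" by (rule LeastI)
  then obtain k where k: "(LEAST k. P k) = Suc k" using x by (cases "LEAST k. P k") (auto simp: P_def)
  have "\<not> P k" using not_less_Least[of k P] k by simp
  then have "x + (int k + 1) * int s \<in> first_gaps s B"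
    using least unfolding k by (auto simp: P_def first_gaps_def algebra_simps)
  then show "x \<in> below s (first_gaps s B)" unfolding below_def by blast
qed

lemma partition_beta_le:
  assumes "\<mu> \<in> partitions" "x \<in> beta \<mu>"
  shows "x \<le> int (\<mu> 1)"
  using assms partition_antimono[OF assms(1), of 1] by (force simp: beta_def)

text \<open>Truncation at \<open>-R\<close> keeps exactly \<open>R\<close> beta numbers, so
  \<open>card + L\<close> vanishes in the sum of the gaps. The truncated beta numbers sum to the
  size minus \<open>R (R + 1) / 2\<close>, and all dependence on \<open>R\<close> cancels in the sum
  of squares.\<close>

lemma first_gaps_beta:
  assumes "1 \<le> s" "1 \<le> t" "\<mu> \<in> cores s \<inter> cores t"
  shows "first_gaps s (beta \<mu>) \<in> first_gap_sets s t"
    and "(\<Sum>b\<in>first_gaps s (beta \<mu>). b\<^sup>2) = 2 * int s * int (psize \<mu>) + (\<Sum>i<s. (int i)\<^sup>2)"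
proof -
  let ?B = "beta \<mu>"
  have \<mu>: "\<mu> \<in> partitions" and stable: "\<And>x. x \<in> ?B \<Longrightarrow> x - int s \<in> ?B"
    and stable_t: "\<And>x. x \<in> ?B \<Longrightarrow> x - int t \<in> ?B"
    using assms cores_iff_beta by auto
  obtain R where R: "\<And>r. r > R \<Longrightarrow> \<mu> r = 0" using partition_finite_length[OF \<mu>] by metis
  have low: "x \<in> ?B" if "x < - int R" for x using beta_truncate(2) R that by blast
  have fin: "finite (?B \<inter> {- int R..})" using beta_truncate(1) R by simp
  have card: "card (?B \<inter> {- int R..}) = R"
    using sum_beta_truncate[OF \<mu> R, where h = "\<lambda>_. 1 :: nat"] by simp
  have two_sum: "2 * (\<Sum>r\<in>{1..R}. int r) = int R * (int R + 1)"
    by (induction R) (auto simp: algebra_simps)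
  have sum: "2 * \<Sum>(?B \<inter> {- int R..}) = 2 * int (psize \<mu>) - int R * (int R + 1)"
    using sum_beta_truncate[OF \<mu> R, where h = "\<lambda>x. x"] two_sum
    by (simp add: psize_eq_sum[OF R] sum_subtractf)
  note sums = sum_first_gaps[OF stable low fin]
  have "(\<Sum>b\<in>first_gaps s ?B. b\<^sup>2) = int s * (2 * \<Sum>(?B \<inter> {- int R..})) + (int s)\<^sup>2 * int R
      + (\<Sum>i<s. (int i)\<^sup>2) - int R * int s * (int s - 1) + int s * (int R)\<^sup>2"
    using sums(3) unfolding card by simp
  then show "(\<Sum>b\<in>first_gaps s ?B. b\<^sup>2) = 2 * int s * int (psize \<mu>) + (\<Sum>i<s. (int i)\<^sup>2)"
    unfolding sum by (simp add: power2_eq_square algebra_simps)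
  have inj: "b = b'" if b: "b \<in> first_gaps s ?B" "b' \<in> first_gaps s ?B" and dvd: "int s dvd b - b'" for b b'
  proof -
    have not_less: "\<not> b1 < b2" if "b1 \<in> first_gaps s ?B" "b2 \<in> first_gaps s ?B" "int s dvd b2 - b1" for b1 b2
    proof
      assume "b1 < b2"
      from that(3) obtain j where j: "b2 - b1 = int s * j" by (auto elim: dvdE)
      then have "0 < int s * j" using \<open>b1 < b2\<close> by linarith
      then have "j > 0" using assms(1) by (simp add: zero_less_mult_iff)
      \<comment> \<open>Descending \<open>j - 1\<close> further steps from the member
        \<open>b2 - s\<close> would make the gap \<open>b1\<close> a member.\<close>
      have "b2 - int s - int (nat (j - 1)) * int s = b1"
        using j \<open>j > 0\<close> by (simp add: algebra_simps)
      then have "b1 \<in> ?B"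
        using iterate_shift[where B = ?B and s = s and k = "nat (j - 1)" and x = "b2 - int s", OF stable] that(2)
        by (simp add: first_gaps_def)
      then show False using that(1) by (simp add: first_gaps_def)
    qed
    have "int s dvd b' - b" using dvd by (metis dvd_minus_iff minus_diff_eq)
    then show ?thesis using not_less[OF b] not_less[OF b(2,1) dvd] by simp
  qed
  have "\<exists>k::nat. b + int t - int k * int s \<in> first_gaps s ?B" if b: "b \<in> first_gaps s ?B" for b
  proof -
    \<comment> \<open>The least \<open>k\<close> with \<open>P k\<close> locates the first gap in
      the residue class of \<open>b + t\<close>.\<close>
    define P where "P k \<longleftrightarrow> b + int t - (int k + 1) * int s \<in> ?B" for k :: nat
    obtain n :: nat where n: "b + int t + int R \<le> int n" using zle_iff_zadd nat_le_iff by blast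
    define p where "p = (int n + 1) * int s"
    have "int n + 1 \<le> p"
      unfolding p_def using assms(1) mult_left_mono[of 1 "int s" "int n + 1"] by simp
    then have "b + int t - p < - int R" using n by linarith
    then have "P n" unfolding P_def p_def by (rule low)
    then have least: "P (LEAST k. P k)" by (rule LeastI)
    have "b + int t - int (LEAST k. P k) * int s \<notin> ?B"
    proof (cases "LEAST k. P k")
      case 0
      \<comment> \<open>Here \<open>t\<close>-stability enters: if \<open>b + t\<close> were a
        member, so would be the gap \<open>b\<close>.\<close>
      then show ?thesis using stable_t[of "b + int t"] b by (auto simp: first_gaps_def)
    next
      case (Suc k)
      then have "\<not> P k" using not_less_Least[of k P] by simp
      then show ?thesis unfolding Suc by (simp add: P_def algebra_simps)
    qed
    then have "b + int t - int (LEAST k. P k) * int s \<in> first_gaps s ?B"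
      using least by (simp add: P_def first_gaps_def algebra_simps)
    then show ?thesis by blast
  qed
  then show "first_gaps s ?B \<in> first_gap_sets s t"
    using first_gaps_telescope(1)[OF stable low fin] sums(1,2) inj unfolding card first_gap_sets_def by simp
qed

section \<open>Reconstructing a stable set from its first gaps\<close>

lemma first_gap_sets_residue:
  assumes "1 \<le> s" "T \<in> first_gap_sets s t"
  obtains b where "b \<in> T" "int s dvd b - x"
proof -
  have T: "finite T" "card T = s" "\<And>b b'. b \<in> T \<Longrightarrow> b' \<in> T \<Longrightarrow> int s dvd b - b' \<Longrightarrow> b = b'"
    using assms(2) by (auto simp: first_gap_sets_def)
  have "inj_on (\<lambda>b. b mod int s) T" using T(3) by (auto intro!: inj_onI simp: mod_eq_dvd_iff)
  then have "card ((\<lambda>b. b mod int s) ` T) = card {0..<int s}" using T(2) by (simp add: card_image)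
  moreover have "(\<lambda>b. b mod int s) ` T \<subseteq> {0..<int s}" using assms(1) by auto
  ultimately have "(\<lambda>b. b mod int s) ` T = {0..<int s}" by (intro card_subset_eq) auto
  moreover have "x mod int s \<in> {0..<int s}" using assms(1) by simp
  ultimately obtain b where "b \<in> T" "x mod int s = b mod int s" by (metis imageE)
  then show thesis using that[of b] by (metis mod_eq_dvd_iff)
qed

text \<open>Since \<open>T\<close> is a complete residue system, each \<open>x\<close> has a unique
  integer \<open>j\<close> with \<open>x + j * s\<close> in \<open>T\<close>, and \<open>x\<close>
  lies in \<open>below s T\<close> iff \<open>j > 0\<close>. All claims are read off from this
  index.\<close>

lemma below_first_gap_sets:
  assumes "1 \<le> s" "T \<in> first_gap_sets s t"
  shows "x \<in> below s T \<Longrightarrow> x - int s \<in> below s T"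
    and "x \<in> below s T \<Longrightarrow> x - int t \<in> below s T"
    and "first_gaps s (below s T) = T"
    and "\<exists>R. (\<forall>x < - int R. x \<in> below s T) \<and> finite (below s T \<inter> {- int R..})
        \<and> card (below s T \<inter> {- int R..}) = R"
proof -
  have T: "finite T" "card T = s" "\<And>b b'. b \<in> T \<Longrightarrow> b' \<in> T \<Longrightarrow> int s dvd b - b' \<Longrightarrow> b = b'"
    "2 * \<Sum>T = int s * (int s - 1)" "\<And>b. b \<in> T \<Longrightarrow> \<exists>k::nat. b + int t - int k * int s \<in> T"
    using assms(2) by (auto simp: first_gap_sets_def)
  have unique: "i = j" if "x + i * int s \<in> T" "x + j * int s \<in> T" for x i j
  proof -
    have "(x + i * int s) - (x + j * int s) = int s * (i - j)" by (simp add: algebra_simps)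
    then have "x + i * int s = x + j * int s" using T(3)[OF that] by (metis dvd_triv_left)
    then show ?thesis using assms(1) by simp
  qed
  have exists_index: "\<exists>j. x + j * int s \<in> T" for x
  proof -
    obtain b where b: "b \<in> T" "int s dvd b - x" using first_gap_sets_residue[OF assms] by metis
    from b(2) obtain j where "b - x = int s * j" by (auto elim: dvdE)
    then have "b = x + j * int s" by (simp add: algebra_simps)
    then show ?thesis using b(1) by blast
  qed
  have memI: "x \<in> below s T" if "x + j * int s \<in> T" "0 < j" for x j
    using that by (auto simp: below_def intro!: exI[of _ "nat (j - 1)"])
  have memE: "\<exists>j>0. x + j * int s \<in> T" if "x \<in> below s T" for x
    using that by (force simp: below_def)
  show stable: "x - int s \<in> below s T" if "x \<in> below s T" for x
  proof -
    obtain j where "j > 0" "x + j * int s \<in> T" using memE \<open>x \<in> below s T\<close> by blast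
    then show ?thesis by (intro memI[of _ "j + 1"]) (auto simp: algebra_simps)
  qed
  show "x - int t \<in> below s T" if x: "x \<in> below s T" for x
  proof -
    obtain i where i: "i > 0" "x + i * int s \<in> T" using memE[OF x] by blast
    obtain j where j: "x - int t + j * int s \<in> T" using exists_index by blast
    then obtain k :: nat where "x - int t + j * int s + int t - int k * int s \<in> T" using T(5) by blast
    then have "x + (j - int k) * int s \<in> T" by (simp add: algebra_simps)
    \<comment> \<open>Passing from \<open>x\<close> to \<open>x - t\<close> raises the index by
      \<open>k \<ge> 0\<close>, so it stays positive.\<close>
    then have "j - int k = i" using unique i(2) by blast
    then show ?thesis using memI[OF j] i(1) by simp
  qed
  show first_gaps: "first_gaps s (below s T) = T"
  proof (intro equalityI subsetI)
    fix x assume x: "x \<in> first_gaps s (below s T)"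
    then obtain j where "j > 0" "x - int s + j * int s \<in> T" using memE by (auto simp: first_gaps_def)
    then have j: "x + (j - 1) * int s \<in> T" by (simp add: algebra_simps)
    then have "\<not> 0 < j - 1" using memI x by (auto simp: first_gaps_def)
    then have "j = 1" using \<open>j > 0\<close> by simp
    then show "x \<in> T" using j by simp
  next
    fix x assume x: "x \<in> T"
    then have "x - int s \<in> below s T" by (intro memI[of _ 1]) auto
    moreover have "x \<notin> below s T"
    proof
      assume "x \<in> below s T"
      then obtain j where "j > 0" "x + j * int s \<in> T" using memE by blast
      then show False using unique[of x j 0] x by simp
    qed
    ultimately show "x \<in> first_gaps s (below s T)" by (simp add: first_gaps_def)
  qed
  \<comment> \<open>With \<open>R\<close> bounding \<open>T\<close> in absolute value, all integers
    below \<open>-R\<close> are members and none above \<open>R\<close> is. The prescribed sum of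
    \<open>T\<close> then forces the charge to be zero.\<close>
  define R where "R = nat (Max (abs ` T))"
  have R: "\<bar>b\<bar> \<le> int R" if "b \<in> T" for b
  proof -
    have "\<bar>b\<bar> \<le> Max (abs ` T)" using T(1) that by simp
    then show ?thesis unfolding R_def by linarith
  qed
  have low: "x \<in> below s T" if "x < - int R" for x
  proof -
    obtain j where j: "x + j * int s \<in> T" using exists_index by blast
    then have "0 < j * int s" using R[OF j] that by simp
    then show ?thesis using memI[OF j] by (simp add: zero_less_mult_iff)
  qed
  have "x \<le> int R" if x: "x \<in> below s T" for x
  proof -
    obtain j where j: "j > 0" "x + j * int s \<in> T" using memE[OF x] by blast
    moreover have "0 \<le> j * int s" using j(1) by simp
    ultimately show ?thesis using R[OF j(2)] by linarith
  qed
  then have "below s T \<inter> {- int R..} \<subseteq> {- int R..int R}" by auto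
  then have fin: "finite (below s T \<inter> {- int R..})" using finite_subset by blast
  have "2 * int s * (int (card (below s T \<inter> {- int R..})) + - int R) = 0"
    using sum_first_gaps(2)[OF stable low fin] T(4) unfolding first_gaps by simp
  then have "card (below s T \<inter> {- int R..}) = R" using assms(1) by simp
  then show "\<exists>R. (\<forall>x < - int R. x \<in> below s T) \<and> finite (below s T \<inter> {- int R..})
        \<and> card (below s T \<inter> {- int R..}) = R"
    using low fin by blast
qed

lemma bij_betw_cores_first_gap_sets:
  assumes "1 \<le> s" "1 \<le> t"
  shows "bij_betw (\<lambda>\<mu>. first_gaps s (beta \<mu>)) (cores s \<inter> cores t) (first_gap_sets s t)"
proof (intro bij_betw_imageI inj_onI equalityI subsetI)
  fix \<mu> \<nu> assume \<mu>: "\<mu> \<in> cores s \<inter> cores t" and \<nu>: "\<nu> \<in> cores s \<inter> cores t"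
    and eq: "first_gaps s (beta \<mu>) = first_gaps s (beta \<nu>)"
  have part: "\<mu> \<in> partitions" "\<nu> \<in> partitions" using \<mu> \<nu> by (auto simp: cores_def)
  have "below s (first_gaps s (beta \<mu>)) = beta \<mu>" if "\<mu> \<in> cores s \<inter> cores t" for \<mu>
    using that cores_iff_beta[OF assms(1)] partition_beta_le
    by (intro below_first_gaps[OF assms(1), where M = "int (\<mu> 1)"]) auto
  then have "beta \<mu> = beta \<nu>" using \<mu> \<nu> eq by metis
  then show "\<mu> = \<nu>" using inj_on_beta part by (auto dest: inj_onD)
next
  fix T assume "T \<in> (\<lambda>\<mu>. first_gaps s (beta \<mu>)) ` (cores s \<inter> cores t)"
  then show "T \<in> first_gap_sets s t" using first_gaps_beta(1)[OF assms] by blast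
next
  fix T assume T: "T \<in> first_gap_sets s t"
  note B = below_first_gap_sets[OF assms(1) T]
  obtain R where R: "\<forall>x < - int R. x \<in> below s T" "finite (below s T \<inter> {- int R..})"
    "card (below s T \<inter> {- int R..}) = R"
    using B(4) by blast
  then obtain \<mu> where \<mu>: "\<mu> \<in> partitions" "beta \<mu> = below s T" using beta_surj by metis
  then have "\<mu> \<in> cores s \<inter> cores t" using cores_iff_beta assms B(1,2) by simp
  then show "T \<in> (\<lambda>\<mu>. first_gaps s (beta \<mu>)) ` (cores s \<inter> cores t)"
    using B(3) \<mu>(2) by (intro image_eqI[of _ _ \<mu>]) simp_all
qed

subsection \<open>Moments of weak compositions\<close>

text \<open>Extension by zero from index \<open>s\<close> on lets distinct functions be distinct
  compositions.\<close>

definition weak_comps :: "nat \<Rightarrow> nat \<Rightarrow> (nat \<Rightarrow> nat) set" where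
  "weak_comps s t = {z. (\<forall>i\<ge>s. z i = 0) \<and> (\<Sum>i<s. z i) = t}"

lemma finite_weak_comps: "finite (weak_comps s t)"
proof -
  have "weak_comps s t \<subseteq> {z. \<forall>i. (i \<in> {..<s} \<longrightarrow> z i \<in> {..t}) \<and> (i \<notin> {..<s} \<longrightarrow> z i = 0)}"
  proof (intro subsetI CollectI allI conjI impI)
    fix z i assume z: "z \<in> weak_comps s t"
    show "z i = 0" if "i \<notin> {..<s}" using z that by (simp add: weak_comps_def)
    show "z i \<in> {..t}" if "i \<in> {..<s}"
      using z that member_le_sum[of i "{..<s}" z] by (simp add: weak_comps_def)
  qed
  then show ?thesis
    by (rule finite_subset) (intro finite_set_of_finite_funs; simp)
qed

text \<open>Swapping two parts is an involution of the weak compositions; this exchangeability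
  drives all the moment formulas.\<close>

lemma sum_weak_comps_transpose:
  assumes "i < s" "j < s"
  shows "(\<Sum>z\<in>weak_comps s t. F (z \<circ> transpose i j)) = (\<Sum>z\<in>weak_comps s t. F z)"
proof -
  have bij: "bij_betw (transpose i j) {..<s} {..<s}"
    using assms by (intro bij_betw_byWitness[where f' = "transpose i j"]) (auto simp: transpose_def)
  have "z \<circ> transpose i j \<in> weak_comps s t" if "z \<in> weak_comps s t" for z
    using that assms sum.reindex_bij_betw[OF bij, of z]
    by (auto simp: weak_comps_def transpose_def)
  then show ?thesis
    by (intro sum.reindex_bij_witness[where i = "\<lambda>z. z \<circ> transpose i j" and j = "\<lambda>z. z \<circ> transpose i j"])
       (auto simp: comp_assoc)
qed

lemma sum_weak_comps_coord:
  assumes "i < s" "j < s"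
  shows "(\<Sum>z\<in>weak_comps s t. h (z i)) = (\<Sum>z\<in>weak_comps s t. h (z j))"
  using sum_weak_comps_transpose[OF assms, of "\<lambda>z. h (z j)" t] by simp

lemma sum_weak_comps_product_coord:
  assumes "i < s" "j < s" "j' < s" "i \<noteq> j" "i \<noteq> j'"
  shows "(\<Sum>z\<in>weak_comps s t. real (z i) * real (z j)) = (\<Sum>z\<in>weak_comps s t. real (z i) * real (z j'))"
  using sum_weak_comps_transpose[OF assms(2,3), of "\<lambda>z. real (z i) * real (z j')" t] assms
  by simp

text \<open>Incrementing part \<open>0\<close> is a bijection onto the compositions of
  \<open>Suc t\<close> whose part \<open>0\<close> is nonzero; \<open>h 0 = 0\<close> discards the
  others.\<close>

lemma sum_weak_comps_Suc:
  assumes "1 \<le> s" "h 0 = 0"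
  shows "(\<Sum>z\<in>weak_comps s (Suc t). h (z 0)) = (\<Sum>z\<in>weak_comps s t. h (Suc (z 0)) :: real)"
proof -
  have sum0: "(\<Sum>i<s. z i) = z 0 + (\<Sum>i\<in>{1..<s}. z i)" for z :: "nat \<Rightarrow> nat"
    using assms(1) by (simp add: lessThan_atLeast0 sum.atLeast_Suc_lessThan)
  have "(\<Sum>z\<in>weak_comps s (Suc t). h (z 0)) = (\<Sum>z\<in>{z \<in> weak_comps s (Suc t). z 0 \<noteq> 0}. h (z 0))"
    using assms(2) by (intro sum.mono_neutral_right finite_weak_comps) auto
  also have "\<dots> = (\<Sum>z\<in>weak_comps s t. h (Suc (z 0)))"
    by (rule sum.reindex_bij_witness[where i = "\<lambda>z. z(0 := Suc (z 0))" and j = "\<lambda>z. z(0 := z 0 - 1)"])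
       (use assms(1) in \<open>auto simp: weak_comps_def sum0\<close>)
  finally show ?thesis .
qed

text \<open>The \<open>s\<close> coordinate sums agree by exchangeability, and the parts of each
  composition add up to \<open>t\<close>.\<close>

lemma weak_comps_first_moment:
  assumes "i < s"
  shows "real s * (\<Sum>z\<in>weak_comps s t. real (z i)) = real t * real (card (weak_comps s t))"
proof -
  have "real s * (\<Sum>z\<in>weak_comps s t. real (z i)) = (\<Sum>j<s. \<Sum>z\<in>weak_comps s t. real (z j))"
    using sum_weak_comps_coord[OF _ assms, where t = t and h = real] by simp
  also have "\<dots> = (\<Sum>z\<in>weak_comps s t. real (\<Sum>j<s. z j))"
    by (subst sum.swap) simp
  also have "\<dots> = (\<Sum>z\<in>weak_comps s t. real t)"
    by (intro sum.cong) (auto simp: weak_comps_def)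
  finally show ?thesis by simp
qed

text \<open>Comparing first moments for \<open>t\<close> and \<open>Suc t\<close> through the
  increment bijection gives this recurrence, which stands in for the binomial formula.\<close>

lemma card_weak_comps_Suc:
  assumes "1 \<le> s"
  shows "(real t + 1) * real (card (weak_comps s (Suc t))) = (real t + real s) * real (card (weak_comps s t))"
proof -
  have "(\<Sum>z\<in>weak_comps s (Suc t). real (z 0))
      = (\<Sum>z\<in>weak_comps s t. real (z 0)) + real (card (weak_comps s t))"
    using sum_weak_comps_Suc[OF assms, of real t] by (simp add: sum.distrib)
  then have "real s * (\<Sum>z\<in>weak_comps s (Suc t). real (z 0))
      = real s * (\<Sum>z\<in>weak_comps s t. real (z 0)) + real s * real (card (weak_comps s t))"
    by (simp add: distrib_left)
  then show ?thesis
    using assms by (simp add: weak_comps_first_moment algebra_simps)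
qed

lemma card_weak_comps_pos:
  assumes "1 \<le> s"
  shows "card (weak_comps s t) > 0"
proof -
  have "(\<lambda>i. if i = 0 then t else 0) \<in> weak_comps s t"
    using assms by (simp add: weak_comps_def)
  then show ?thesis using finite_weak_comps card_gt_0_iff by blast
qed

text \<open>Induction on \<open>t\<close> for part \<open>0\<close>: incrementing it turns the
  square sum \<open>Q\<close> into \<open>Q + 2 M + N\<close>, and the recurrence for the
  cardinality absorbs the factor \<open>t + s\<close>. Exchangeability passes to part
  \<open>i\<close>.\<close>

lemma weak_comps_second_moment:
  assumes "i < s"
  shows "real s * (real s + 1) * (\<Sum>z\<in>weak_comps s t. (real (z i))\<^sup>2)
    = real t * (2 * real t + real s - 1) * real (card (weak_comps s t))"
proof -
  have s: "1 \<le> s" using assms by simp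
  have "real s * (real s + 1) * (\<Sum>z\<in>weak_comps s t. (real (z 0))\<^sup>2)
    = real t * (2 * real t + real s - 1) * real (card (weak_comps s t))"
  proof (induction t)
    case 0
    have "z 0 = 0" if "z \<in> weak_comps s 0" for z using that s by (auto simp: weak_comps_def)
    then have "(\<Sum>z\<in>weak_comps s 0. (real (z 0))\<^sup>2) = 0" by (intro sum.neutral) simp
    then show ?case by simp
  next
    case (Suc t)
    let ?N = "real (card (weak_comps s t))" and ?N' = "real (card (weak_comps s (Suc t)))"
    let ?M = "\<Sum>z\<in>weak_comps s t. real (z 0)" and ?Q = "\<Sum>z\<in>weak_comps s t. (real (z 0))\<^sup>2"
    have M: "real s * ?M = real t * ?N" using weak_comps_first_moment[of 0 s t] s by simp
    have N': "(real t + 1) * ?N' = (real t + real s) * ?N" using card_weak_comps_Suc[OF s] .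
    have "(\<Sum>z\<in>weak_comps s (Suc t). (real (z 0))\<^sup>2) = ?Q + 2 * ?M + ?N"
      using sum_weak_comps_Suc[OF s, of "\<lambda>x. (real x)\<^sup>2" t]
      by (simp add: power2_eq_square algebra_simps sum.distrib sum_distrib_left)
    then have "real s * (real s + 1) * (\<Sum>z\<in>weak_comps s (Suc t). (real (z 0))\<^sup>2)
      = real s * (real s + 1) * ?Q + 2 * (real s + 1) * (real s * ?M) + real s * (real s + 1) * ?N"
      by (simp add: algebra_simps)
    also have "\<dots> = (2 * real t + real s + 1) * ((real t + real s) * ?N)"
      unfolding Suc.IH M by (simp add: algebra_simps)
    finally show ?case unfolding N'[symmetric] by (simp add: algebra_simps)
  qed
  then show ?thesis using sum_weak_comps_coord[where i = i and j = 0 and s = s and t = t and h = "\<lambda>x. (real x)\<^sup>2"] assms s by simp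
qed

text \<open>For fixed \<open>i\<close> the \<open>s - 1\<close> mixed moments are equal, and
  together they sum \<open>z i * (t - z i)\<close>. Two distinct indices below \<open>s\<close> make
  \<open>s - 1\<close> nonzero, so it can be cancelled.\<close>

lemma weak_comps_mixed_moment:
  assumes "i < s" "j < s" "i \<noteq> j"
  shows "real s * (real s + 1) * (\<Sum>z\<in>weak_comps s t. real (z i) * real (z j))
    = real t * (real t - 1) * real (card (weak_comps s t))"
proof -
  let ?W = "weak_comps s t"
  let ?C = "\<Sum>z\<in>?W. real (z i) * real (z j)"
  have "(real s - 1) * ?C = (\<Sum>k\<in>{..<s} - {i}. \<Sum>z\<in>?W. real (z i) * real (z k))"
  proof -
    have "(\<Sum>k\<in>{..<s} - {i}. \<Sum>z\<in>?W. real (z i) * real (z k)) = (\<Sum>k\<in>{..<s} - {i}. ?C)"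
      by (rule sum.cong[OF refl], rule sum_weak_comps_product_coord) (use assms in auto)
    then show ?thesis using assms(1) by (simp add: of_nat_diff)
  qed
  also have "\<dots> = (\<Sum>z\<in>?W. \<Sum>k\<in>{..<s} - {i}. real (z i) * real (z k))" by (rule sum.swap)
  also have "\<dots> = (\<Sum>z\<in>?W. real t * real (z i) - (real (z i))\<^sup>2)"
  proof (rule sum.cong)
    fix z assume "z \<in> ?W"
    then have "real t = (\<Sum>k<s. real (z k))" by (auto simp: weak_comps_def simp flip: of_nat_sum)
    also have "\<dots> = real (z i) + (\<Sum>k\<in>{..<s} - {i}. real (z k))"
      using assms(1) by (simp add: sum.remove)
    finally have "(\<Sum>k\<in>{..<s} - {i}. real (z k)) = real t - real (z i)" by simp
    then show "(\<Sum>k\<in>{..<s} - {i}. real (z i) * real (z k)) = real t * real (z i) - (real (z i))\<^sup>2"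
      by (simp add: power2_eq_square right_diff_distrib flip: sum_distrib_left)
  qed simp
  also have "\<dots> = real t * (\<Sum>z\<in>?W. real (z i)) - (\<Sum>z\<in>?W. (real (z i))\<^sup>2)"
    by (simp add: sum_subtractf sum_distrib_left)
  finally have C: "(real s - 1) * ?C = real t * (\<Sum>z\<in>?W. real (z i)) - (\<Sum>z\<in>?W. (real (z i))\<^sup>2)" .
  have "(real s - 1) * (real s * (real s + 1) * ?C) = real s * (real s + 1) * ((real s - 1) * ?C)"
    by (simp only: mult_ac)
  also have "\<dots> = (real s + 1) * real t * (real s * (\<Sum>z\<in>?W. real (z i))) - real s * (real s + 1) * (\<Sum>z\<in>?W. (real (z i))\<^sup>2)"
    unfolding C by (simp add: algebra_simps)
  also have "\<dots> = (real s - 1) * (real t * (real t - 1) * real (card ?W))"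
    unfolding weak_comps_first_moment[OF assms(1)] weak_comps_second_moment[OF assms(1)]
    by (simp add: algebra_simps)
  finally show ?thesis using assms by (subst (asm) mult_left_cancel) auto
qed

text \<open>Expanding the square gives \<open>n\<close> second moments and \<open>n (n - 1)\<close>
  mixed moments.\<close>

lemma weak_comps_block_square:
  assumes "I \<subseteq> {..<s}" "card I = n" "1 \<le> s"
  shows "real s * (real s + 1) * (\<Sum>z\<in>weak_comps s t. (\<Sum>i\<in>I. real (z i))\<^sup>2)
    = real n * real t * (2 * real t + real s - 1 + (real n - 1) * (real t - 1)) * real (card (weak_comps s t))"
proof -
  let ?W = "weak_comps s t" and ?N = "real (card (weak_comps s t))"
  have fin: "finite I" using assms(1) finite_subset by blast
  have "(\<Sum>z\<in>?W. (\<Sum>i\<in>I. real (z i))\<^sup>2) = (\<Sum>z\<in>?W. \<Sum>i\<in>I. \<Sum>j\<in>I. real (z i) * real (z j))"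
    by (simp add: power2_eq_square sum_product)
  also have "\<dots> = (\<Sum>i\<in>I. \<Sum>z\<in>?W. \<Sum>j\<in>I. real (z i) * real (z j))" by (rule sum.swap)
  also have "\<dots> = (\<Sum>i\<in>I. \<Sum>j\<in>I. \<Sum>z\<in>?W. real (z i) * real (z j))"
    by (intro sum.cong refl sum.swap)
  finally have "real s * (real s + 1) * (\<Sum>z\<in>?W. (\<Sum>i\<in>I. real (z i))\<^sup>2)
    = (\<Sum>i\<in>I. \<Sum>j\<in>I. real s * (real s + 1) * (\<Sum>z\<in>?W. real (z i) * real (z j)))"
    by (simp add: sum_distrib_left)
  also have "\<dots> = (\<Sum>i\<in>I. real t * (2 * real t + real s - 1) * ?N
      + (real n - 1) * (real t * (real t - 1) * ?N))"
  proof (rule sum.cong)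
    fix i assume i: "i \<in> I"
    have "(\<Sum>j\<in>I. real s * (real s + 1) * (\<Sum>z\<in>?W. real (z i) * real (z j)))
      = real s * (real s + 1) * (\<Sum>z\<in>?W. (real (z i))\<^sup>2)
        + (\<Sum>j\<in>I - {i}. real s * (real s + 1) * (\<Sum>z\<in>?W. real (z i) * real (z j)))"
      using fin i by (simp add: sum.remove power2_eq_square)
    also have "(\<Sum>j\<in>I - {i}. real s * (real s + 1) * (\<Sum>z\<in>?W. real (z i) * real (z j)))
      = (\<Sum>j\<in>I - {i}. real t * (real t - 1) * ?N)"
      using assms(1) i by (intro sum.cong refl weak_comps_mixed_moment) auto
    also have "\<dots> = real (card I - 1) * (real t * (real t - 1) * ?N)"
      using fin i by simp
    also have "real (card I - 1) = real n - 1"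
      using assms(2) fin i card_gt_0_iff[of I] by (auto simp: of_nat_diff Suc_le_eq)
    finally show "(\<Sum>j\<in>I. real s * (real s + 1) * (\<Sum>z\<in>?W. real (z i) * real (z j)))
      = real t * (2 * real t + real s - 1) * ?N + (real n - 1) * (real t * (real t - 1) * ?N)"
      using weak_comps_second_moment[of i s t] assms(1) i by auto
  qed simp
  also have "\<dots> = real n * real t * (2 * real t + real s - 1 + (real n - 1) * (real t - 1)) * ?N"
    using assms(2) by (simp add: algebra_simps)
  finally show ?thesis .
qed

text \<open>The squared quantity is, up to sign, \<open>s\<close> times the deviation of the block
  sum from its mean \<open>n t / s\<close>. In this form it is a difference of two walk
  positions.\<close>

lemma weak_comps_block_variance:
  assumes "I \<subseteq> {..<s}" "card I = n" "1 \<le> s"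
  shows "(real s + 1) * (\<Sum>z\<in>weak_comps s t. (real n * real t - real s * (\<Sum>i\<in>I. real (z i)))\<^sup>2)
    = real n * (real s - real n) * real t * (real s + real t) * real (card (weak_comps s t))"
proof -
  let ?W = "weak_comps s t" and ?N = "real (card (weak_comps s t))"
  let ?Q = "\<Sum>z\<in>?W. (\<Sum>i\<in>I. real (z i))\<^sup>2"
  have "real s * (\<Sum>z\<in>?W. \<Sum>i\<in>I. real (z i)) = (\<Sum>i\<in>I. real s * (\<Sum>z\<in>?W. real (z i)))"
    by (subst sum.swap) (simp add: sum_distrib_left)
  also have "\<dots> = (\<Sum>i\<in>I. real t * ?N)"
    using assms(1) by (intro sum.cong refl weak_comps_first_moment) auto
  finally have M: "real s * (\<Sum>z\<in>?W. \<Sum>i\<in>I. real (z i)) = real n * real t * ?N"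
    using assms(2) by simp
  have "(\<Sum>z\<in>?W. (real n * real t - real s * (\<Sum>i\<in>I. real (z i)))\<^sup>2)
    = (\<Sum>z\<in>?W. (real n * real t)\<^sup>2 - 2 * real n * real t * (real s * (\<Sum>i\<in>I. real (z i)))
        + (real s)\<^sup>2 * (\<Sum>i\<in>I. real (z i))\<^sup>2)"
    by (intro sum.cong refl) (simp add: power2_eq_square algebra_simps)
  also have "\<dots> = (real n * real t)\<^sup>2 * ?N
      - 2 * real n * real t * (real s * (\<Sum>z\<in>?W. \<Sum>i\<in>I. real (z i))) + (real s)\<^sup>2 * ?Q"
    by (simp add: sum.distrib sum_subtractf sum_distrib_left)
  finally have expand: "(\<Sum>z\<in>?W. (real n * real t - real s * (\<Sum>i\<in>I. real (z i)))\<^sup>2)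
    = (real n * real t)\<^sup>2 * ?N - 2 * real n * real t * (real n * real t * ?N) + (real s)\<^sup>2 * ?Q"
    unfolding M .
  have expand_id: "(a + 1) * ((c * b)\<^sup>2 * N - 2 * c * b * (c * b * N) + a\<^sup>2 * Q)
      = a * (a * (a + 1) * Q) - (a + 1) * (c * b)\<^sup>2 * N" for a b c N Q :: real
    by (simp add: power2_eq_square algebra_simps)
  have "(real s + 1) * (\<Sum>z\<in>?W. (real n * real t - real s * (\<Sum>i\<in>I. real (z i)))\<^sup>2)
    = real s * (real s * (real s + 1) * ?Q) - (real s + 1) * (real n * real t)\<^sup>2 * ?N"
    unfolding expand by (rule expand_id)
  also have "\<dots> = real n * (real s - real n) * real t * (real s + real t) * ?N"
    unfolding weak_comps_block_square[OF assms] by (simp add: power2_eq_square algebra_simps)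
  finally show ?thesis .
qed

subsection \<open>Pointed gap sets and weak compositions\<close>

text \<open>The position after \<open>k\<close> steps relative to the base point; step
  \<open>i\<close> adds \<open>t\<close> and then descends \<open>z i\<close> multiples of
  \<open>s\<close>.\<close>

definition walk :: "nat \<Rightarrow> nat \<Rightarrow> (nat \<Rightarrow> nat) \<Rightarrow> nat \<Rightarrow> int" where
  "walk s t z k = int k * int t - int s * (\<Sum>i<k. int (z i))"

text \<open>The base point that gives the \<open>s\<close> positions the sum
  \<open>0 + 1 + ... + (s - 1)\<close>; the division is exact when \<open>s\<close> and
  \<open>t\<close> are coprime.\<close>

definition offset :: "nat \<Rightarrow> nat \<Rightarrow> (nat \<Rightarrow> nat) \<Rightarrow> int" where
  "offset s t z = ((\<Sum>i<s. int i) - (\<Sum>k<s. walk s t z k)) div int s"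

definition gap_set :: "nat \<Rightarrow> nat \<Rightarrow> (nat \<Rightarrow> nat) \<Rightarrow> int set" where
  "gap_set s t z = (\<lambda>k. offset s t z + walk s t z k) ` {..<s}"

lemma walk_0 [simp]: "walk s t z 0 = 0"
  by (simp add: walk_def)

lemma walk_Suc: "walk s t z (Suc k) = walk s t z k + int t - int s * int (z k)"
  by (simp add: walk_def algebra_simps)

lemma walk_full:
  assumes "z \<in> weak_comps s t"
  shows "walk s t z s = 0"
proof -
  have "(\<Sum>i<s. int (z i)) = int t" using assms by (auto simp: weak_comps_def simp flip: of_nat_sum)
  then show ?thesis by (simp add: walk_def)
qed

lemma coprime_residue_unique:
  assumes "coprime s t" "j < s" "k < s" "int s dvd (int j - int k) * int t"
  shows "j = k"
proof -
  have "coprime (int s) (int t)" using assms(1) by simp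
  then have "int s dvd int j - int k" using assms(4) by (simp add: coprime_dvd_mult_left_iff)
  moreover have "\<bar>int j - int k\<bar> < int s" using assms(2,3) by linarith
  ultimately show ?thesis using dvd_imp_le_int[of "int j - int k" "int s"] by fastforce
qed

text \<open>Position \<open>k\<close> is congruent to \<open>k * t\<close> modulo \<open>s\<close>
  whatever the composition, which also allows two different walks to be compared.\<close>

lemma walk_residue_unique:
  assumes "coprime s t" "j < s" "k < s" "int s dvd walk s t z j - walk s t z' k"
  shows "j = k"
proof -
  have "(int j - int k) * int t = (walk s t z j - walk s t z' k)
      + int s * ((\<Sum>i<j. int (z i)) - (\<Sum>i<k. int (z' i)))"
    by (simp add: walk_def algebra_simps)
  then have "int s dvd (int j - int k) * int t" using assms(4) by (metis dvd_add dvd_triv_left)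
  then show ?thesis using coprime_residue_unique assms(1-3) by blast
qed

text \<open>Reduction modulo \<open>s\<close> permutes \<open>w\<close> onto
  \<open>0, ..., s - 1\<close> and changes each term by a multiple of \<open>s\<close>.\<close>

lemma dvd_sum_complete_residues:
  assumes "1 \<le> s" "\<And>j k. j < s \<Longrightarrow> k < s \<Longrightarrow> int s dvd w j - w k \<Longrightarrow> j = k"
  shows "int s dvd (\<Sum>i<s. int i) - (\<Sum>k<s. w k)"
proof -
  have inj: "inj_on (\<lambda>k. w k mod int s) {..<s}"
    using assms(2) by (auto intro!: inj_onI simp: mod_eq_dvd_iff)
  have "(\<lambda>k. w k mod int s) ` {..<s} = {0..<int s}"
    using assms(1) card_image[OF inj] by (intro card_subset_eq) auto
  then have "(\<Sum>k<s. w k mod int s) = \<Sum>{0..<int s}"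
    using sum.reindex[OF inj, of "\<lambda>x. x"] by simp
  also have "\<dots> = (\<Sum>i<s. int i)" using sum_int_interval[of "\<lambda>x. x" 0 s] by simp
  finally have "(\<Sum>i<s. int i) - (\<Sum>k<s. w k) = - (\<Sum>k<s. w k - w k mod int s)"
    by (simp add: sum_subtractf)
  moreover have "int s dvd (\<Sum>k<s. w k - w k mod int s)" by (intro dvd_sum) simp
  ultimately show ?thesis by simp
qed

lemma offset_sum:
  assumes "1 \<le> s" "coprime s t"
  shows "(\<Sum>k<s. offset s t z + walk s t z k) = (\<Sum>i<s. int i)"
proof -
  have "int s dvd (\<Sum>i<s. int i) - (\<Sum>k<s. walk s t z k)"
    using walk_residue_unique[OF assms(2)] assms(1) by (intro dvd_sum_complete_residues) auto
  then have "int s * offset s t z = (\<Sum>i<s. int i) - (\<Sum>k<s. walk s t z k)"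
    by (simp add: offset_def)
  then show ?thesis by (simp add: sum.distrib)
qed

lemma sum_gap_set:
  assumes "coprime s t"
  shows "(\<Sum>b\<in>gap_set s t z. h b) = (\<Sum>k<s. h (offset s t z + walk s t z k))"
proof -
  have "inj_on (\<lambda>k. offset s t z + walk s t z k) {..<s}"
    using walk_residue_unique[OF assms, of _ _ z z] by (auto intro!: inj_onI)
  then show ?thesis unfolding gap_set_def by (simp add: sum.reindex)
qed

lemma gap_set_in_first_gap_sets:
  assumes "1 \<le> s" "coprime s t" "z \<in> weak_comps s t"
  shows "gap_set s t z \<in> first_gap_sets s t"
proof -
  let ?T = "gap_set s t z"
  have "card ?T = s" using sum_gap_set[OF assms(2), of "\<lambda>_. 1 :: nat" z] by simp
  moreover have "2 * \<Sum>?T = int s * (int s - 1)"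
    using sum_gap_set[OF assms(2), of "\<lambda>b. b" z] offset_sum[OF assms(1,2)] two_sum_lessThan by simp
  moreover have "b = b'" if b: "b \<in> ?T" "b' \<in> ?T" "int s dvd b - b'" for b b'
  proof -
    obtain j k where jk: "j < s" "k < s" "b = offset s t z + walk s t z j" "b' = offset s t z + walk s t z k"
      using b(1,2) by (auto simp: gap_set_def)
    then show ?thesis using walk_residue_unique[OF assms(2) jk(1,2), of z z] b(3) by simp
  qed
  moreover have "\<exists>k::nat. b + int t - int k * int s \<in> ?T" if b: "b \<in> ?T" for b
  proof -
    obtain k where k: "k < s" "b = offset s t z + walk s t z k" using b by (auto simp: gap_set_def)
    have "b + int t - int (z k) * int s = offset s t z + walk s t z (Suc k)"
      using k(2) by (simp add: walk_Suc)
    also have "\<dots> \<in> ?T"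
    proof (cases "Suc k = s")
      case True
      \<comment> \<open>The walk closes up after \<open>s\<close> steps, so the successor of the
        last position is the base point.\<close>
      then have "walk s t z (Suc k) = walk s t z 0" using walk_full[OF assms(3)] by simp
      then show ?thesis using k(1) unfolding gap_set_def by (intro image_eqI[of _ _ 0]) auto
    next
      case False
      then show ?thesis using k(1) unfolding gap_set_def by (intro image_eqI[of _ _ "Suc k"]) auto
    qed
    finally show ?thesis by blast
  qed
  ultimately show ?thesis by (auto simp: first_gap_sets_def gap_set_def)
qed

text \<open>Position \<open>k\<close> is the only element of the gap set in its residue class, so
  set and base point determine the walk, and its increments determine the parts.\<close>

lemma pointed_gap_set_inj:
  assumes "coprime s t" "z \<in> weak_comps s t" "z' \<in> weak_comps s t"
    and "gap_set s t z = gap_set s t z'" "offset s t z = offset s t z'"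
  shows "z = z'"
proof
  have walk_eq: "walk s t z k = walk s t z' k" if "k \<le> s" for k
  proof (cases "k = s")
    case False
    then have "k < s" using that by simp
    then have "offset s t z + walk s t z k \<in> gap_set s t z'"
      using assms(4) by (auto simp: gap_set_def)
    then obtain l where l: "l < s" "walk s t z k = walk s t z' l"
      using assms(5) by (auto simp: gap_set_def)
    then have "k = l" using walk_residue_unique[OF assms(1) \<open>k < s\<close> l(1), of z z'] by simp
    then show ?thesis using l(2) by simp
  qed (use assms(2,3) in \<open>simp add: walk_full\<close>)
  show "z k = z' k" for k
  proof (cases "k < s")
    case True
    then have "int s * int (z k) = int s * int (z' k)"
      using walk_Suc[of s t z k] walk_Suc[of s t z' k] walk_eq[of k] walk_eq[of "Suc k"] by simp
    then show ?thesis using True by simp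
  next
    case False
    then show ?thesis using assms(2,3) by (simp add: weak_comps_def)
  qed
qed

text \<open>Let \<open>d k\<close> be the element of \<open>T\<close> congruent to
  \<open>b + k t\<close>. The last condition on \<open>T\<close> makes each part read off from the
  increments nonnegative, and the return \<open>d s = b\<close> makes the parts sum to
  \<open>t\<close>.\<close>

lemma pointed_gap_set_surj:
  assumes "1 \<le> s" "coprime s t" "T \<in> first_gap_sets s t" "b \<in> T"
  obtains z where "z \<in> weak_comps s t" "gap_set s t z = T" "offset s t z = b"
proof -
  have T: "finite T" "card T = s" "\<And>b b'. b \<in> T \<Longrightarrow> b' \<in> T \<Longrightarrow> int s dvd b - b' \<Longrightarrow> b = b'"
    "2 * \<Sum>T = int s * (int s - 1)" "\<And>b. b \<in> T \<Longrightarrow> \<exists>k::nat. b + int t - int k * int s \<in> T"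
    using assms(3) by (auto simp: first_gap_sets_def)
  have "\<forall>k. \<exists>x. x \<in> T \<and> int s dvd x - (b + int k * int t)"
    using first_gap_sets_residue[OF assms(1,3)] by metis
  then obtain d where d: "\<And>k. d k \<in> T" "\<And>k. int s dvd d k - (b + int k * int t)" by metis
  have d_eq: "d k = x" if "x \<in> T" "int s dvd x - (b + int k * int t)" for k x
    using T(3)[OF d(1) that(1)] dvd_diff[OF d(2)[of k] that(2)] by (simp add: algebra_simps)
  have d0: "d 0 = b" and ds: "d s = b" using assms(4) by (auto intro!: d_eq)
  have "\<forall>k. \<exists>n::nat. d (Suc k) = d k + int t - int n * int s"
  proof
    fix k
    obtain n :: nat where n: "d k + int t - int n * int s \<in> T" using T(5) d(1) by blast
    have "int s dvd (d k - (b + int k * int t)) - int n * int s" using dvd_diff[OF d(2)[of k] dvd_triv_right] .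
    then have "d (Suc k) = d k + int t - int n * int s"
      by (intro d_eq n) (simp add: algebra_simps)
    then show "\<exists>n::nat. d (Suc k) = d k + int t - int n * int s" by blast
  qed
  then obtain y where y: "\<And>k. d (Suc k) = d k + int t - int (y k) * int s" by metis
  define z where "z k = (if k < s then y k else 0)" for k
  have walk: "k \<le> s \<longrightarrow> walk s t z k = d k - b" for k
    by (induction k) (auto simp: d0 walk_Suc y z_def)
  have "int s * int t = int s * (\<Sum>i<s. int (z i))" using walk[of s] ds by (simp add: walk_def)
  then have "int t = int (\<Sum>i<s. z i)" using assms(1) by simp
  then have z: "z \<in> weak_comps s t" unfolding weak_comps_def z_def of_nat_eq_iff by simp
  have inj: "inj_on d {..<s}"
  proof (rule inj_onI)
    fix j k assume jk: "j \<in> {..<s}" "k \<in> {..<s}" "d j = d k"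
    then have "walk s t z j = walk s t z k" using walk by simp
    then show "j = k" using walk_residue_unique[OF assms(2), of j k z z] jk by simp
  qed
  have d_image: "d ` {..<s} = T"
    using d(1) T(1,2) card_image[OF inj] by (intro card_subset_eq) auto
  have "(\<Sum>k<s. walk s t z k) = (\<Sum>k<s. d k - b)" using walk by (intro sum.cong) auto
  also have "\<dots> = \<Sum>T - int s * b"
    using sum.reindex[OF inj, of "\<lambda>x. x"] by (simp add: d_image sum_subtractf)
  finally have "(\<Sum>i<s. int i) - (\<Sum>k<s. walk s t z k) = int s * b"
    using T(4) two_sum_lessThan[of s] by simp
  then have offset: "offset s t z = b" using assms(1) by (simp add: offset_def)
  have "gap_set s t z = d ` {..<s}"
    unfolding gap_set_def offset using walk by (intro image_cong) auto
  then show thesis using that z offset d_image by simp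
qed

lemma bij_betw_weak_comps_pointed:
  assumes "1 \<le> s" "coprime s t"
  shows "bij_betw (\<lambda>z. (gap_set s t z, offset s t z)) (weak_comps s t) (SIGMA T:first_gap_sets s t. T)"
proof (intro bij_betw_imageI inj_onI equalityI subsetI)
  fix z z' assume "z \<in> weak_comps s t" "z' \<in> weak_comps s t"
    "(gap_set s t z, offset s t z) = (gap_set s t z', offset s t z')"
  then show "z = z'" using pointed_gap_set_inj[OF assms(2)] by simp
next
  fix p assume "p \<in> (\<lambda>z. (gap_set s t z, offset s t z)) ` weak_comps s t"
  then obtain z where z: "z \<in> weak_comps s t" "p = (gap_set s t z, offset s t z)" by blast
  have "offset s t z \<in> gap_set s t z"
    unfolding gap_set_def using assms(1) by (intro image_eqI[of _ _ 0]) auto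
  then show "p \<in> (SIGMA T:first_gap_sets s t. T)" using gap_set_in_first_gap_sets[OF assms z(1)] z(2) by simp
next
  fix p assume "p \<in> (SIGMA T:first_gap_sets s t. T)"
  then obtain T b where p: "p = (T, b)" "T \<in> first_gap_sets s t" "b \<in> T" by blast
  obtain z where "z \<in> weak_comps s t" "gap_set s t z = T" "offset s t z = b"
    using pointed_gap_set_surj[OF assms p(2,3)] by metis
  then show "p \<in> (\<lambda>z. (gap_set s t z, offset s t z)) ` weak_comps s t" using p(1) by force
qed

text \<open>Each \<open>T\<close> has \<open>s\<close> possible base points, hence arises from
  \<open>s\<close> compositions.\<close>

lemma sum_weak_comps_gap_set:
  fixes f :: "int set \<Rightarrow> real"
  assumes "1 \<le> s" "coprime s t"
  shows "(\<Sum>z\<in>weak_comps s t. f (gap_set s t z)) = real s * (\<Sum>T\<in>first_gap_sets s t. f T)"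
proof -
  note bij = bij_betw_weak_comps_pointed[OF assms]
  have T: "finite T" "card T = s" if "T \<in> first_gap_sets s t" for T
    using that by (auto simp: first_gap_sets_def)
  have "first_gap_sets s t \<subseteq> fst ` (SIGMA T:first_gap_sets s t. T)"
  proof
    fix T assume "T \<in> first_gap_sets s t"
    moreover from this obtain b where "b \<in> T" using T(2)[of T] assms(1) by fastforce
    ultimately show "T \<in> fst ` (SIGMA T:first_gap_sets s t. T)" by (intro image_eqI[of _ _ "(T, b)"]) auto
  qed
  moreover have "finite (SIGMA T:first_gap_sets s t. T)"
    using bij_betw_finite[OF bij] finite_weak_comps by blast
  ultimately have fin: "finite (first_gap_sets s t)" using finite_surj by blast
  have "(\<Sum>z\<in>weak_comps s t. f (gap_set s t z)) = (\<Sum>p\<in>(SIGMA T:first_gap_sets s t. T). f (fst p))"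
    using sum.reindex_bij_betw[OF bij, of "\<lambda>p. f (fst p)"] by simp
  also have "\<dots> = (\<Sum>T\<in>first_gap_sets s t. \<Sum>b\<in>T. f T)"
    using sum.Sigma[of "first_gap_sets s t" "\<lambda>T. T" "\<lambda>T b. f T"] fin T(1) by (simp add: case_prod_unfold)
  also have "\<dots> = (\<Sum>T\<in>first_gap_sets s t. real s * f T)"
    using T by (intro sum.cong) auto
  finally show ?thesis by (simp add: sum_distrib_left)
qed

section \<open>Averaging the sum of squares over all compositions\<close>

text \<open>Used to trade the squares of the gaps for their known total and their pairwise
  differences, from which the offset drops out.\<close>

lemma two_sum_squares_eq:
  fixes d :: "nat \<Rightarrow> real"
  shows "2 * real s * (\<Sum>k<s. (d k)\<^sup>2) = 2 * (\<Sum>k<s. d k)\<^sup>2 + (\<Sum>j<s. \<Sum>k<s. (d j - d k)\<^sup>2)"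
proof -
  have "(\<Sum>j<s. \<Sum>k<s. (d j - d k)\<^sup>2) = (\<Sum>j<s. \<Sum>k<s. (d j)\<^sup>2 + (d k)\<^sup>2 - 2 * (d j * d k))"
    by (simp add: power2_diff mult.assoc)
  also have "\<dots> = 2 * real s * (\<Sum>k<s. (d k)\<^sup>2) - 2 * (\<Sum>j<s. \<Sum>k<s. d j * d k)"
    by (simp add: sum.distrib sum_subtractf sum_distrib_left mult.assoc)
  also have "(\<Sum>j<s. \<Sum>k<s. d j * d k) = (\<Sum>k<s. d k)\<^sup>2"
    by (simp add: power2_eq_square sum_product)
  finally show ?thesis by simp
qed

text \<open>The parameter \<open>a\<close> is kept apart from \<open>n\<close> so that induction on
  \<open>n\<close> is possible; the application has \<open>a = n = s\<close>.\<close>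

lemma sum_distance_form:
  "6 * (\<Sum>j<n. \<Sum>k<n. \<bar>real j - real k\<bar> * (a - \<bar>real j - real k\<bar>))
    = 2 * a * (real n ^ 3 - real n) - (real n)\<^sup>2 * ((real n)\<^sup>2 - 1)"
proof (induction n)
  case (Suc n)
  let ?g = "\<lambda>j k. \<bar>real j - real k\<bar> * (a - \<bar>real j - real k\<bar>)"
  \<comment> \<open>The contribution of the new row, and equally of the new column, with
    \<open>n\<close> replaced by a free \<open>c\<close> inside the summand so that it too can be
    proved by induction.\<close>
  have row: "6 * (\<Sum>j<n. (c - real j) * (a - (c - real j)))
    = real n * (6 * c * (a - c) - 3 * (a - 2 * c) * (real n - 1) - (real n - 1) * (2 * real n - 1))" for c
    by (induction n) (simp_all add: algebra_simps power2_eq_square)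
  have "(\<Sum>j<Suc n. \<Sum>k<Suc n. ?g j k) = (\<Sum>j<n. \<Sum>k<n. ?g j k) + (\<Sum>j<n. ?g j n) + (\<Sum>k<n. ?g n k)"
    by (simp add: sum.distrib)
  also have "(\<Sum>j<n. ?g j n) = (\<Sum>j<n. (real n - real j) * (a - (real n - real j)))"
    by (intro sum.cong) auto
  also have "(\<Sum>k<n. ?g n k) = (\<Sum>j<n. (real n - real j) * (a - (real n - real j)))"
    by (intro sum.cong) auto
  finally have "6 * (\<Sum>j<Suc n. \<Sum>k<Suc n. ?g j k)
    = 6 * (\<Sum>j<n. \<Sum>k<n. ?g j k) + 2 * (6 * (\<Sum>j<n. (real n - real j) * (a - (real n - real j))))"
    by (simp only: distrib_left)
  then show ?case unfolding Suc.IH row by (simp add: algebra_simps power2_eq_square power3_eq_cube)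
qed simp

text \<open>Between positions \<open>j \<le> k\<close> the walk moves by \<open>(k - j) t\<close>
  minus \<open>s\<close> times the block sum over \<open>{j..<k}\<close>, so the block variance
  applies.\<close>

lemma walk_difference_second_moment:
  assumes "1 \<le> s" "j < s" "k < s"
  shows "(real s + 1) * (\<Sum>z\<in>weak_comps s t. (real_of_int (walk s t z j) - real_of_int (walk s t z k))\<^sup>2)
    = \<bar>real j - real k\<bar> * (real s - \<bar>real j - real k\<bar>) * (real t * (real s + real t) * real (card (weak_comps s t)))"
proof -
  have *: "(real s + 1) * (\<Sum>z\<in>weak_comps s t. (real_of_int (walk s t z k) - real_of_int (walk s t z j))\<^sup>2)
    = (real k - real j) * (real s - (real k - real j)) * (real t * (real s + real t) * real (card (weak_comps s t)))"
    if "j \<le> k" "k < s" for j k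
  proof -
    have "real_of_int (walk s t z k) - real_of_int (walk s t z j)
      = real (k - j) * real t - real s * (\<Sum>i\<in>{j..<k}. real (z i))" for z
    proof -
      have "(\<Sum>i<k. real (z i)) = (\<Sum>i<j. real (z i)) + (\<Sum>i\<in>{j..<k}. real (z i))"
        using that(1) by (simp add: lessThan_atLeast0 sum.atLeastLessThan_concat)
      then show ?thesis using that(1) by (simp add: walk_def algebra_simps of_nat_diff)
    qed
    then show ?thesis
      using weak_comps_block_variance[of "{j..<k}" s "k - j" t] that assms(1)
      by (simp add: of_nat_diff mult.assoc subset_eq)
  qed
  show ?thesis
  proof (cases "j \<le> k")
    case True
    then show ?thesis using *[of j k] assms(3) by (simp add: power2_commute)
  next
    case False
    then show ?thesis using *[of k j] assms(2) by simp
  qed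
qed

lemma sum_weak_comps_gap_set_squares:
  assumes "1 \<le> s" "coprime s t"
  shows "12 * (\<Sum>z\<in>weak_comps s t. \<Sum>b\<in>gap_set s t z. (real_of_int b)\<^sup>2)
    = real s * (real s - 1) * (3 * (real s - 1) + real t * (real s + real t)) * real (card (weak_comps s t))"
proof -
  let ?W = "weak_comps s t" and ?N = "real (card (weak_comps s t))"
  let ?w = "\<lambda>z k. real_of_int (walk s t z k)" and ?d = "\<lambda>z k. real_of_int (offset s t z + walk s t z k)"
  let ?D = "\<Sum>z\<in>?W. \<Sum>j<s. \<Sum>k<s. (?w z j - ?w z k)\<^sup>2"
  have "?D = (\<Sum>j<s. \<Sum>z\<in>?W. \<Sum>k<s. (?w z j - ?w z k)\<^sup>2)" by (rule sum.swap)
  also have "\<dots> = (\<Sum>j<s. \<Sum>k<s. \<Sum>z\<in>?W. (?w z j - ?w z k)\<^sup>2)" by (intro sum.cong refl sum.swap)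
  finally have "(real s + 1) * ?D = (\<Sum>j<s. \<Sum>k<s. (real s + 1) * (\<Sum>z\<in>?W. (?w z j - ?w z k)\<^sup>2))"
    by (simp add: sum_distrib_left)
  also have "\<dots> = (\<Sum>j<s. \<Sum>k<s. \<bar>real j - real k\<bar> * (real s - \<bar>real j - real k\<bar>) * (real t * (real s + real t) * ?N))"
    by (intro sum.cong refl walk_difference_second_moment) (use assms(1) in auto)
  also have "\<dots> = (\<Sum>j<s. \<Sum>k<s. \<bar>real j - real k\<bar> * (real s - \<bar>real j - real k\<bar>)) * (real t * (real s + real t) * ?N)"
    by (simp only: sum_distrib_right)
  finally have "6 * ((real s + 1) * ?D)
    = 6 * (\<Sum>j<s. \<Sum>k<s. \<bar>real j - real k\<bar> * (real s - \<bar>real j - real k\<bar>)) * (real t * (real s + real t) * ?N)"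
    by simp
  also have "\<dots> = (real s + 1) * ((real s)\<^sup>2 * (real s - 1) * (real t * (real s + real t) * ?N))"
    unfolding sum_distance_form by (simp add: algebra_simps power2_eq_square power3_eq_cube)
  finally have "(real s + 1) * (6 * ?D) = (real s + 1) * ((real s)\<^sup>2 * (real s - 1) * (real t * (real s + real t) * ?N))"
    by simp
  then have D: "6 * ?D = (real s)\<^sup>2 * (real s - 1) * (real t * (real s + real t) * ?N)"
    by (subst (asm) mult_left_cancel) auto
  have sum_d: "2 * (\<Sum>k<s. ?d z k) = real s * (real s - 1)" for z
  proof -
    have "2 * (\<Sum>k<s. offset s t z + walk s t z k) = int s * (int s - 1)"
      using offset_sum[OF assms] two_sum_lessThan by simp
    then have "real_of_int (2 * (\<Sum>k<s. offset s t z + walk s t z k)) = real_of_int (int s * (int s - 1))"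
      by (rule arg_cong)
    then show ?thesis by simp
  qed
  have "2 * real s * (\<Sum>b\<in>gap_set s t z. (real_of_int b)\<^sup>2)
    = (real s * (real s - 1))\<^sup>2 / 2 + (\<Sum>j<s. \<Sum>k<s. (?w z j - ?w z k)\<^sup>2)" for z
  proof -
    have "(\<Sum>k<s. ?d z k) = real s * (real s - 1) / 2" using sum_d[of z] by linarith
    then have "2 * (\<Sum>k<s. ?d z k)\<^sup>2 = (real s * (real s - 1))\<^sup>2 / 2" by (simp only: power_divide) simp
    then show ?thesis
      using two_sum_squares_eq[of s "?d z"] by (simp add: sum_gap_set[OF assms(2)])
  qed
  then have "2 * real s * (\<Sum>z\<in>?W. \<Sum>b\<in>gap_set s t z. (real_of_int b)\<^sup>2)
    = (\<Sum>z\<in>?W. (real s * (real s - 1))\<^sup>2 / 2 + (\<Sum>j<s. \<Sum>k<s. (?w z j - ?w z k)\<^sup>2))"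
    unfolding sum_distrib_left by simp
  also have "\<dots> = ?N * (real s * (real s - 1))\<^sup>2 / 2 + ?D"
    by (simp add: sum.distrib)
  finally have "real s * (12 * (\<Sum>z\<in>?W. \<Sum>b\<in>gap_set s t z. (real_of_int b)\<^sup>2))
    = 3 * ?N * (real s * (real s - 1))\<^sup>2 + 6 * ?D"
    by simp
  also have "\<dots> = real s * (real s * (real s - 1) * (3 * (real s - 1) + real t * (real s + real t)) * ?N)"
    unfolding D by (simp add: algebra_simps power2_eq_square)
  finally show ?thesis using assms(1) by (subst (asm) mult_left_cancel) auto
qed

section \<open>The average size of a simultaneous core\<close>

lemma six_sum_squares_lessThan: "6 * (\<Sum>i<s. (real i)\<^sup>2) = real s * (real s - 1) * (2 * real s - 1)"
  by (induction s) (simp_all add: algebra_simps power2_eq_square)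

theorem theorem1p1:
  fixes s t :: nat
  assumes "s \<ge> 1" and "t \<ge> 1" and "coprime s t"
  shows "(\<Sum>\<mu> \<in> cores s \<inter> cores t. real (psize \<mu>)) / (\<Sum>\<mu> \<in> cores s \<inter> cores t. 1)
    = 1 / 24 * (real s - 1) * (real t - 1) * (real s + real t + 1)"
proof -
  let ?C = "cores s \<inter> cores t" and ?N = "real (card (weak_comps s t))"
  let ?c = "real (card (cores s \<inter> cores t))" and ?P = "\<Sum>\<mu>\<in>cores s \<inter> cores t. real (psize \<mu>)"
  \<comment> \<open>Both bijections combined: summing over compositions is \<open>s\<close> times
    summing over cores.\<close>
  have transfer: "(\<Sum>z\<in>weak_comps s t. f (gap_set s t z)) = real s * (\<Sum>\<mu>\<in>?C. f (first_gaps s (beta \<mu>)))"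
    for f :: "int set \<Rightarrow> real"
    using sum_weak_comps_gap_set[OF assms(1,3), of f]
      sum.reindex_bij_betw[OF bij_betw_cores_first_gap_sets[OF assms(1,2)], of f] by simp
  \<comment> \<open>The constant function counts the cores; as compositions exist, the denominator
    is nonzero.\<close>
  have N: "?N = real s * ?c" using transfer[of "\<lambda>_. 1"] by simp
  then have "?c \<noteq> 0" using card_weak_comps_pos[OF assms(1), of t]
    by (metis less_irrefl mult_zero_right of_nat_eq_0_iff)
  have squares: "(\<Sum>b\<in>first_gaps s (beta \<mu>). (real_of_int b)\<^sup>2) = 2 * real s * real (psize \<mu>) + (\<Sum>i<s. (real i)\<^sup>2)"
    if "\<mu> \<in> ?C" for \<mu>
  proof -
    have "real_of_int (\<Sum>b\<in>first_gaps s (beta \<mu>). b\<^sup>2) = real_of_int (2 * int s * int (psize \<mu>) + (\<Sum>i<s. (int i)\<^sup>2))"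
      using first_gaps_beta(2)[OF assms(1,2) that] by simp
    then show ?thesis by simp
  qed
  have "(\<Sum>z\<in>weak_comps s t. \<Sum>b\<in>gap_set s t z. (real_of_int b)\<^sup>2)
    = real s * (\<Sum>\<mu>\<in>?C. 2 * real s * real (psize \<mu>) + (\<Sum>i<s. (real i)\<^sup>2))"
    using transfer[of "\<lambda>T. \<Sum>b\<in>T. (real_of_int b)\<^sup>2"] squares by simp
  also have "\<dots> = real s * (2 * real s * ?P + ?c * (\<Sum>i<s. (real i)\<^sup>2))"
    by (simp add: sum.distrib sum_distrib_left)
  finally have "real s * (24 * real s * ?P + 2 * ?c * (6 * (\<Sum>i<s. (real i)\<^sup>2)))
    = real s * (real s * (real s - 1) * (3 * (real s - 1) + real t * (real s + real t)) * ?c)"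
    using sum_weak_comps_gap_set_squares[OF assms(1,3)] unfolding N by (simp add: algebra_simps)
  then have "24 * real s * ?P + 2 * ?c * (6 * (\<Sum>i<s. (real i)\<^sup>2))
    = real s * (real s - 1) * (3 * (real s - 1) + real t * (real s + real t)) * ?c"
    using assms(1) by (subst (asm) mult_left_cancel) auto
  \<comment> \<open>After the squares of \<open>0, ..., s - 1\<close> are removed, the factor left
    is \<open>3 (s - 1) + t (s + t) - 2 (2 s - 1) = (t - 1) (s + t + 1)\<close>.\<close>
  then have "real s * (24 * ?P) = real s * ((real s - 1) * (real t - 1) * (real s + real t + 1) * ?c)"
    unfolding six_sum_squares_lessThan by (simp add: algebra_simps)
  then have "24 * ?P = (real s - 1) * (real t - 1) * (real s + real t + 1) * ?c"
    using assms(1) by (subst (asm) mult_left_cancel) auto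
  then show ?thesis using \<open>?c \<noteq> 0\<close> by (simp add: field_simps)
qed

end
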